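(* Let $d\ge 2$ and let $T$ be a self-adjoint, bounded multi-Toeplitz operator on the Fock space $\mathcal F_d$. For each $N$ let $T_N=P_NTP_N$, and let $\lambda_1^{(N)},\lambda_2^{(N)},\dots,\lambda_{d_N}^{(N)}$ be the eigenvalues of $T_N$ (counted with multiplicity). Then there exists a unique Borel probability measure $\mu_T$ on $\mathbb R$ such that for every continuous function $f:\mathbb R\to\mathbb C$, $$\lim_{N\to\infty}\frac1{d_N}\sum_{i=1}^{d_N} f\bigl(\lambda_i^{(N)}\bigr)=\int_{\mathbb R} f\,d\mu_T .$$ Moreover, if $[a,b]$ is the smallest interval containing the spectrum of $T$, then $\mu_T$ is supported in $[a,b]$.
   Context: The Fock space on $d$ generators is the Hilbert space direct sum $\mathcal F_d=\bigoplus_{n=0}^\infty \mathcal H_n$ with $\mathcal H_0=\mathbb C$ and $\mathcal H_n=(\mathbb C^d)^{\otimes n}$ for $n\ge 1$. Let $e_1,\dots,e_d$ be the standard basis of $\mathbb C^d$. For a word $w=i_1\cdots i_n$ in the letters $\{1,\dots,d\}$ of length $|w|=n$, put $\xi_w=e_{i_1}\otimes\cdots\otimes e_{i_n}\in\mathcal H_n$ (for the empty word, $\xi_w=1\in\mathcal H_0$); the vectors $\xi_w$ form an orthonormal basis of $\mathcal F_d$. The right shifts $R_1,\dots,R_d$ on $\mathcal F_d$ are the isometries $R_i\xi=\xi\otimes e_i$ (i.e. $R_i\xi_w=\xi_{wi}$). A bounded operator $T$ on $\mathcal F_d$ is called multi-Toeplitz if $R_i^*TR_j=\delta_{ij}T$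 for all $i,j\in\{1,\dots,d\}$. $P_N$ denotes the orthogonal projection of $\mathcal F_d$ onto $\mathrm{span}\{\xi_w:|w|\le N\}$, and $d_N=\operatorname{rank}P_N=1+d+d^2+\cdots+d^N$. The truncation $T_N=P_NTP_N$ is regarded as an operator on the $d_N$-dimensional range of $P_N$. *)

theory Defs
  imports "HOL-Probability.Probability" "Jordan_Normal_Form.Char_Poly"
begin

section \<open>The complex Hilbert space of square-summable families\<close>

lemma square_summable_prod:
  fixes f g :: "'a \<Rightarrow> complex"
  assumes "(\<lambda>a. (cmod (f a))\<^sup>2) summable_on UNIV" and "(\<lambda>a. (cmod (g a))\<^sup>2) summable_on UNIV"
  shows "(\<lambda>a. f a * g a) summable_on UNIV"
  by (rule abs_summable_summable, rule abs_summable_product)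
    (use assms in \<open>simp_all add: norm_mult power2_eq_square\<close>)

lemma square_summable_add:
  fixes f g :: "'a \<Rightarrow> complex"
  assumes "(\<lambda>a. (cmod (f a))\<^sup>2) summable_on UNIV" and "(\<lambda>a. (cmod (g a))\<^sup>2) summable_on UNIV"
  shows "(\<lambda>a. (cmod (f a + g a))\<^sup>2) summable_on UNIV"
proof (rule summable_on_comparison_test)
  show "(\<lambda>a. 2 * (cmod (f a))\<^sup>2 + 2 * (cmod (g a))\<^sup>2) summable_on UNIV"
    by (intro summable_on_add summable_on_cmult_right assms)
  fix a
  have "(cmod (f a + g a))\<^sup>2 \<le> (cmod (f a) + cmod (g a))\<^sup>2"
    by (intro power_mono norm_triangle_ineq norm_ge_zero)
  also have "\<dots> \<le> 2 * (cmod (f a))\<^sup>2 + 2 * (cmod (g a))\<^sup>2"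
    using sum_squares_bound[of "cmod (f a)" "cmod (g a)"] by (simp add: power2_sum)
  finally show "(cmod (f a + g a))\<^sup>2 \<le> 2 * (cmod (f a))\<^sup>2 + 2 * (cmod (g a))\<^sup>2" .
qed simp

lemma square_summable_scale:
  fixes f :: "'a \<Rightarrow> complex"
  assumes "(\<lambda>a. (cmod (f a))\<^sup>2) summable_on UNIV"
  shows "(\<lambda>a. (cmod (c * f a))\<^sup>2) summable_on UNIV"
  using summable_on_cmult_right[OF assms, of "(cmod c)\<^sup>2"] by (simp add: norm_mult power_mult_distrib)

typedef 'a ell2 = "{f :: 'a \<Rightarrow> complex. (\<lambda>a. (cmod (f a))\<^sup>2) summable_on UNIV}"
  morphisms coord Abs_ell2
  by (rule exI[of _ "\<lambda>_. 0"]) simp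

setup_lifting type_definition_ell2

lemma coord_square_summable: "(\<lambda>a. (cmod (coord x a))\<^sup>2) summable_on UNIV"
  using coord by blast

lemma ell2_eqI: "(\<And>a. coord x a = coord y a) \<Longrightarrow> x = y"
  by (metis coord_inject ext)

lift_definition scaleC :: "complex \<Rightarrow> 'a ell2 \<Rightarrow> 'a ell2" (infixr "*\<^sub>C" 75)
  is "\<lambda>c f a. c * f a"
  by (rule square_summable_scale)

lift_definition cinner :: "'a ell2 \<Rightarrow> 'a ell2 \<Rightarrow> complex"
  is "\<lambda>f g. \<Sum>\<^sub>\<infinity>a. f a * cnj (g a)" .

instantiation ell2 :: (type) ab_group_add
begin

lift_definition zero_ell2 :: "'a ell2" is "\<lambda>_. 0" by simp
lift_definition plus_ell2 :: "'a ell2 \<Rightarrow> 'a ell2 \<Rightarrow> 'a ell2" is "\<lambda>f g a. f a + g a"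
  by (rule square_summable_add)
lift_definition uminus_ell2 :: "'a ell2 \<Rightarrow> 'a ell2" is "\<lambda>f a. - f a" by simp
lift_definition minus_ell2 :: "'a ell2 \<Rightarrow> 'a ell2 \<Rightarrow> 'a ell2" is "\<lambda>f g a. f a - g a"
  using square_summable_add[of _ "\<lambda>a. - _ a"] by simp

instance
  by standard (transfer; simp add: fun_eq_iff algebra_simps)+

end

instantiation ell2 :: (type) real_vector
begin

lift_definition scaleR_ell2 :: "real \<Rightarrow> 'a ell2 \<Rightarrow> 'a ell2" is "\<lambda>r f a. complex_of_real r * f a"
  by (rule square_summable_scale)

instance
  by standard (transfer; simp add: fun_eq_iff algebra_simps)+

end

lemma coord_simps [simp]:
  "coord 0 a = 0"
  "coord (x + y) a = coord x a + coord y a"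
  "coord (- x) a = - coord x a"
  "coord (x - y) a = coord x a - coord y a"
  "coord (r *\<^sub>R x) a = complex_of_real r * coord x a"
  "coord (c *\<^sub>C x) a = c * coord x a"
  by (simp_all add: zero_ell2.rep_eq plus_ell2.rep_eq uminus_ell2.rep_eq minus_ell2.rep_eq
      scaleR_ell2.rep_eq scaleC.rep_eq)

lemma cinner_summable: "(\<lambda>a. coord x a * cnj (coord y a)) summable_on UNIV"
  by (rule square_summable_prod) (simp_all add: coord_square_summable)

lemma cinner_add_left: "cinner (x + y) z = cinner x z + cinner y z"
  using infsum_add[OF cinner_summable[of x z] cinner_summable[of y z]]
  by (simp add: cinner.rep_eq algebra_simps)

lemma cinner_scaleC_left: "cinner (c *\<^sub>C x) y = c * cinner x y"
  by (simp add: cinner.rep_eq mult.assoc infsum_cmult_right')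

lemma cinner_scaleR_left: "cinner (r *\<^sub>R x) y = complex_of_real r * cinner x y"
  by (simp add: cinner.rep_eq mult.assoc infsum_cmult_right')

lemma cinner_commute: "cinner x y = cnj (cinner y x)"
  by (simp add: cinner.rep_eq mult.commute flip: infsum_cnj)

lemma cinner_self: "cinner x x = complex_of_real (\<Sum>\<^sub>\<infinity>a. (cmod (coord x a))\<^sup>2)"
  unfolding cinner.rep_eq
  by (rule trans[OF _ infsumI[OF has_sum_of_real[OF has_sum_infsum[OF coord_square_summable[of x]]]]])
    (intro infsum_cong complex_norm_square[symmetric])

instantiation ell2 :: (type) real_inner
begin

definition inner_ell2 :: "'a ell2 \<Rightarrow> 'a ell2 \<Rightarrow> real" where
  "inner_ell2 x y = Re (cinner x y)"
definition norm_ell2 :: "'a ell2 \<Rightarrow> real" where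
  "norm_ell2 x = sqrt (\<Sum>\<^sub>\<infinity>a. (cmod (coord x a))\<^sup>2)"
definition dist_ell2 :: "'a ell2 \<Rightarrow> 'a ell2 \<Rightarrow> real" where
  "dist_ell2 x y = norm (x - y)"
definition sgn_ell2 :: "'a ell2 \<Rightarrow> 'a ell2" where
  "sgn_ell2 x = x /\<^sub>R norm x"
definition uniformity_ell2 :: "('a ell2 \<times> 'a ell2) filter" where
  "uniformity_ell2 = (INF e\<in>{0<..}. principal {(x, y). dist x y < e})"
definition open_ell2 :: "'a ell2 set \<Rightarrow> bool" where
  "open_ell2 U = (\<forall>x\<in>U. eventually (\<lambda>(x', y). x' = x \<longrightarrow> y \<in> U) uniformity)"

instance
proof
  fix x y z :: "'a ell2" and r :: real
  show "inner x y = inner y x"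
    by (metis cinner_commute cnj.simps(1) inner_ell2_def)
  show "inner (x + y) z = inner x z + inner y z"
    by (simp add: inner_ell2_def cinner_add_left)
  show "inner (r *\<^sub>R x) y = r * inner x y"
    by (simp add: inner_ell2_def cinner_scaleR_left)
  show "0 \<le> inner x x"
    by (simp add: inner_ell2_def cinner_self infsum_nonneg)
  show "inner x x = 0 \<longleftrightarrow> x = 0"
  proof
    assume "inner x x = 0"
    then have "(\<Sum>\<^sub>\<infinity>a. (cmod (coord x a))\<^sup>2) \<le> 0"
      by (simp add: inner_ell2_def cinner_self)
    then have "(cmod (coord x a))\<^sup>2 = 0" for a
      by (rule nonneg_infsum_le_0D) (simp_all add: coord_square_summable)
    then show "x = 0"
      by (intro ell2_eqI) simp
  qed (simp add: inner_ell2_def cinner.rep_eq)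
  show "norm x = sqrt (inner x x)"
    by (simp add: inner_ell2_def cinner_self norm_ell2_def)
qed (simp_all add: dist_ell2_def sgn_ell2_def uniformity_ell2_def open_ell2_def)

end

lift_definition ket :: "'a \<Rightarrow> 'a ell2" is "\<lambda>b a. if a = b then 1 else 0"
proof -
  fix b :: 'a
  show "(\<lambda>a. (cmod (if a = b then 1 else 0))\<^sup>2) summable_on UNIV"
    by (subst summable_on_cong_neutral[where T = "{b}" and g = "\<lambda>_. 1"]) auto
qed

lemma cinner_ket_right: "cinner x (ket a) = coord x a"
proof -
  have "(\<Sum>\<^sub>\<infinity>b. coord x b * cnj (coord (ket a) b)) = (\<Sum>\<^sub>\<infinity>b\<in>{a}. coord x b)"
    by (rule infsum_cong_neutral) (auto simp: ket.rep_eq)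
  then show ?thesis
    by (simp add: cinner.rep_eq)
qed


section \<open>Bounded operators\<close>

definition bounded_clinear :: "('a ell2 \<Rightarrow> 'a ell2) \<Rightarrow> bool" where
  "bounded_clinear T \<longleftrightarrow> bounded_linear T \<and> (\<forall>c x. T (c *\<^sub>C x) = c *\<^sub>C T x)"

definition is_cadjoint :: "('a ell2 \<Rightarrow> 'a ell2) \<Rightarrow> ('a ell2 \<Rightarrow> 'a ell2) \<Rightarrow> bool" where
  "is_cadjoint S T \<longleftrightarrow> (\<forall>x y. cinner (S x) y = cinner x (T y))"

definition cadjoint :: "('a ell2 \<Rightarrow> 'a ell2) \<Rightarrow> 'a ell2 \<Rightarrow> 'a ell2" where
  "cadjoint T = (THE S. is_cadjoint S T)"

definition selfadjoint :: "('a ell2 \<Rightarrow> 'a ell2) \<Rightarrow> bool" where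
  "selfadjoint T \<longleftrightarrow> is_cadjoint T T"

lemma cadjoint_eqI:
  assumes "is_cadjoint S T"
  shows "cadjoint T = S"
  unfolding cadjoint_def
proof (rule the_equality)
  show "is_cadjoint S T" by (rule assms)
  fix S' assume S': "is_cadjoint S' T"
  show "S' = S"
  proof (intro ext ell2_eqI)
    fix x a
    show "coord (S' x) a = coord (S x) a"
      using S' assms by (simp add: is_cadjoint_def flip: cinner_ket_right)
  qed
qed

definition op_spectrum :: "('a ell2 \<Rightarrow> 'a ell2) \<Rightarrow> complex set" where
  "op_spectrum T = {z. \<not> (\<exists>S. bounded_clinear S \<and>
     (\<forall>x. S (T x - z *\<^sub>C x) = x) \<and> (\<forall>x. T (S x) - z *\<^sub>C S x = x))}"


section \<open>The Fock space\<close>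

text \<open>
  The letters are the elements of a finite type \<^typ>\<open>'d\<close>, words are lists of letters, and
  \<open>d = CARD('d)\<close>. The Fock space is written in the coordinates of its orthonormal basis
  \<open>\<xi>\<^sub>w\<close>, which is \<open>ket w\<close> here: the families supported on the words of length \<open>n\<close> are the summand
  \<open>(\<complex>\<^sup>d)\<^sup>\<otimes>\<^sup>n\<close>, and the Hilbert space direct sum of these consists of all square-summable families
  on words.
\<close>

type_synonym 'd fock = "'d list ell2"

text \<open>Right tensoring with \<open>e\<^sub>i\<close> sends \<open>\<xi>\<^sub>v\<close> to \<open>\<xi>\<^sub>v\<^sub>i\<close>.\<close>

lift_definition right_shift :: "'d \<Rightarrow> 'd fock \<Rightarrow> 'd fock"
  is "\<lambda>i f w. if w \<noteq> [] \<and> last w = i then f (butlast w) else 0"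
proof -
  fix i :: 'd and f :: "'d list \<Rightarrow> complex"
  let ?g = "\<lambda>w. if w \<noteq> [] \<and> last w = i then f (butlast w) else 0"
  assume f: "(\<lambda>w. (cmod (f w))\<^sup>2) summable_on UNIV"
  have "(\<lambda>w. (cmod (?g w))\<^sup>2) summable_on range (\<lambda>v. v @ [i])"
    by (subst summable_on_reindex) (simp_all add: inj_on_def o_def f)
  moreover have "(\<lambda>w. (cmod (?g w))\<^sup>2) summable_on range (\<lambda>v. v @ [i])
      \<longleftrightarrow> (\<lambda>w. (cmod (?g w))\<^sup>2) summable_on UNIV"
  proof (rule summable_on_cong_neutral)
    fix w :: "'d list"
    assume "w \<in> UNIV - range (\<lambda>v. v @ [i])"
    then have "\<not> (w \<noteq> [] \<and> last w = i)"
      by (metis DiffD2 append_butlast_last_id rangeI)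
    then show "(cmod (?g w))\<^sup>2 = 0"
      by auto
  qed auto
  ultimately show "(\<lambda>w. (cmod (?g w))\<^sup>2) summable_on UNIV"
    by simp
qed

lemma right_shift_ket: "right_shift i (ket v) = ket (v @ [i])"
proof (rule ell2_eqI)
  fix w
  show "coord (right_shift i (ket v)) w = coord (ket (v @ [i])) w"
    by (cases w rule: rev_cases) (simp_all add: right_shift.rep_eq ket.rep_eq)
qed

lift_definition right_annihilate :: "'d \<Rightarrow> 'd fock \<Rightarrow> 'd fock"
  is "\<lambda>i f v. f (v @ [i])"
proof -
  fix i :: 'd and f :: "'d list \<Rightarrow> complex"
  assume "(\<lambda>w. (cmod (f w))\<^sup>2) summable_on UNIV"
  then have "(\<lambda>w. (cmod (f w))\<^sup>2) summable_on range (\<lambda>v. v @ [i])"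
    by (rule summable_on_subset_banach) simp
  then show "(\<lambda>v. (cmod (f (v @ [i])))\<^sup>2) summable_on UNIV"
    by (subst (asm) summable_on_reindex) (simp_all add: inj_on_def o_def)
qed

lemma cadjoint_right_shift: "cadjoint (right_shift i) = right_annihilate i"
proof (rule cadjoint_eqI, unfold is_cadjoint_def, intro allI)
  fix x y :: "'a fock"
  have "cinner x (right_shift i y)
      = (\<Sum>\<^sub>\<infinity>w\<in>range (\<lambda>v. v @ [i]). coord x w * cnj (coord (right_shift i y) w))"
    unfolding cinner.rep_eq
  proof (rule infsum_cong_neutral)
    fix w :: "'a list"
    assume "w \<in> UNIV - range (\<lambda>v. v @ [i])"
    then have "\<not> (w \<noteq> [] \<and> last w = i)"
      by (metis DiffD2 append_butlast_last_id rangeI)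
    then show "coord x w * cnj (coord (right_shift i y) w) = 0"
      by (auto simp: right_shift.rep_eq)
  qed auto
  also have "\<dots> = cinner (right_annihilate i x) y"
    by (subst infsum_reindex)
      (simp_all add: inj_on_def o_def cinner.rep_eq right_shift.rep_eq right_annihilate.rep_eq)
  finally show "cinner (right_annihilate i x) y = cinner x (right_shift i y)" ..
qed

definition multi_toeplitz :: "('d fock \<Rightarrow> 'd fock) \<Rightarrow> bool" where
  "multi_toeplitz T \<longleftrightarrow>
     (\<forall>i j. cadjoint (right_shift i) \<circ> T \<circ> right_shift j = (if i = j then T else (\<lambda>_. 0)))"

lift_definition fock_proj :: "nat \<Rightarrow> 'd fock \<Rightarrow> 'd fock"
  is "\<lambda>N f w. if length w \<le> N then f w else 0"
  by (rule summable_on_comparison_test) auto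

text \<open>This is the orthogonal projection onto the span of the \<open>\<xi>\<^sub>w\<close> with \<open>|w| \<le> N\<close>:\<close>

lemma fock_proj_eq_sum:
  fixes x :: "'d::finite fock"
  shows "fock_proj N x = (\<Sum>w | length w \<le> N. cinner x (ket w) *\<^sub>C ket w)"
proof (rule ell2_eqI)
  fix a :: "'d list"
  have fin: "finite {w :: 'd list. length w \<le> N}"
    using finite_lists_length_le[of "UNIV :: 'd set"] by simp
  have "coord (\<Sum>w\<in>W. y w) a = (\<Sum>w\<in>W. coord (y w) a)" for W and y :: "'d list \<Rightarrow> 'd fock"
    by (induction W rule: infinite_finite_induct) simp_all
  then show "coord (fock_proj N x) a = coord (\<Sum>w | length w \<le> N. cinner x (ket w) *\<^sub>C ket w) a"
    using fin by (simp add: cinner_ket_right fock_proj.rep_eq ket.rep_eq sum.delta if_distrib cong: if_cong)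
qed

lemma fock_proj_selfadjoint: "selfadjoint (fock_proj N)"
  unfolding selfadjoint_def is_cadjoint_def cinner.rep_eq
  by (intro allI infsum_cong) (simp add: fock_proj.rep_eq)

definition fock_dim :: "'d itself \<Rightarrow> nat \<Rightarrow> nat" where
  "fock_dim _ N = (\<Sum>k\<le>N. CARD('d) ^ k)"

lemma card_words: "card {w :: 'd::finite list. length w \<le> N} = fock_dim TYPE('d) N"
  using card_lists_length_le[of "UNIV :: 'd set" N] by (simp add: fock_dim_def)

definition truncation :: "nat \<Rightarrow> ('d fock \<Rightarrow> 'd fock) \<Rightarrow> 'd fock \<Rightarrow> 'd fock" where
  "truncation N T = fock_proj N \<circ> T \<circ> fock_proj N"

text \<open>
  Some enumeration of the words of length at most \<open>N\<close>; the characteristic polynomial below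
  does not depend on which one.
\<close>

definition word_enum :: "nat \<Rightarrow> 'd::finite list list" where
  "word_enum N = (SOME ws. distinct ws \<and> set ws = {w. length w \<le> N})"

lemma word_enum:
  shows "distinct (word_enum N :: 'd::finite list list)"
    and "set (word_enum N :: 'd list list) = {w. length w \<le> N}"
    and "length (word_enum N :: 'd list list) = fock_dim TYPE('d) N"
proof -
  have "finite {w :: 'd list. length w \<le> N}"
    using finite_lists_length_le[of "UNIV :: 'd set"] by simp
  then have "\<exists>ws. distinct ws \<and> set ws = {w :: 'd list. length w \<le> N}"
    using finite_distinct_list by blast
  from someI_ex[OF this]
  show *: "distinct (word_enum N :: 'd list list)" "set (word_enum N :: 'd list list) = {w. length w \<le> N}"
    by (simp_all add: word_enum_def)
  then show "length (word_enum N :: 'd list list) = fock_dim TYPE('d) N"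
    by (metis card_words distinct_card)
qed

text \<open>
  The matrix of the truncation, as an operator on the range of \<^const>\<open>fock_proj\<close>, in the
  orthonormal basis \<open>\<xi>\<^sub>w\<close>, \<open>|w| \<le> N\<close>.
\<close>

definition truncation_mat :: "nat \<Rightarrow> ('d::finite fock \<Rightarrow> 'd fock) \<Rightarrow> complex mat" where
  "truncation_mat N T = mat (fock_dim TYPE('d) N) (fock_dim TYPE('d) N)
     (\<lambda>(i, j). cinner (truncation N T (ket (word_enum N ! j))) (ket (word_enum N ! i)))"

text \<open>
  \<open>l 1, \<dots>, l d\<^sub>N\<close> are the eigenvalues of the truncation, counted with multiplicity. They are
  real for self-adjoint \<open>T\<close>; the lemma below says that such an \<open>l\<close> then exists.
\<close>

definition truncation_eigenvalues :: "nat \<Rightarrow> ('d::finite fock \<Rightarrow> 'd fock) \<Rightarrow> (nat \<Rightarrow> real) \<Rightarrow> bool" where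
  "truncation_eigenvalues N T l \<longleftrightarrow>
     char_poly (truncation_mat N T) = (\<Prod>i=1..fock_dim TYPE('d) N. [:- complex_of_real (l i), 1:])"

lemma hermitian_eigenvalue_real:
  fixes A :: "complex mat"
  assumes A: "A \<in> carrier_mat n n"
    and herm: "\<And>i j. i < n \<Longrightarrow> j < n \<Longrightarrow> A $$ (i, j) = cnj (A $$ (j, i))"
    and ev: "eigenvalue A a"
  shows "a \<in> \<real>"
proof -
  from ev A obtain v where v: "v \<in> carrier_vec n" "v \<noteq> 0\<^sub>v n" "A *\<^sub>v v = a \<cdot>\<^sub>v v"
    by (auto simp: eigenvalue_def eigenvector_def)
  let ?v = "\<lambda>i. vec_index v i"
  have row: "(\<Sum>j<n. A $$ (i, j) * ?v j) = a * ?v i" if "i < n" for i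
  proof -
    have "vec_index (A *\<^sub>v v) i = (\<Sum>j<n. A $$ (i, j) * ?v j)"
      using that A v(1) by (simp add: scalar_prod_def atLeast0LessThan)
    then show ?thesis
      using that v by simp
  qed
  define q where "q = (\<Sum>i<n. \<Sum>j<n. cnj (?v i) * (A $$ (i, j) * ?v j))"
  define s where "s = (\<Sum>i<n. (cmod (?v i))\<^sup>2)"
  have "q = (\<Sum>i<n. cnj (?v i) * (a * ?v i))"
    unfolding q_def by (intro sum.cong refl) (simp add: row flip: sum_distrib_left)
  also have "\<dots> = a * complex_of_real s"
    unfolding s_def of_real_sum sum_distrib_left
    by (intro sum.cong refl) (simp only: complex_norm_square mult_ac)
  finally have q: "q = a * complex_of_real s" .
  have "cnj q = (\<Sum>i<n. \<Sum>j<n. cnj (?v j) * (A $$ (j, i) * ?v i))"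
    unfolding q_def cnj_sum by (intro sum.cong refl) (subst herm, auto)
  also have "\<dots> = q"
    unfolding q_def by (rule sum.swap)
  finally have "cnj a * complex_of_real s = a * complex_of_real s"
    using q by (metis complex_cnj_complex_of_real complex_cnj_mult)
  moreover have "s \<noteq> 0"
  proof
    assume "s = 0"
    then have "?v i = 0" if "i < n" for i
      using that by (simp add: s_def sum_nonneg_eq_0_iff)
    with v(1,2) show False
      by auto
  qed
  ultimately show ?thesis
    by (simp add: Reals_cnj_iff)
qed

lemma ex_truncation_eigenvalues:
  fixes T :: "'d::finite fock \<Rightarrow> 'd fock"
  assumes T: "selfadjoint T"
  shows "\<exists>l. truncation_eigenvalues N T l"
proof -
  define n where "n = fock_dim TYPE('d) N"
  define A where "A = truncation_mat N T"
  have A: "A \<in> carrier_mat n n"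
    by (simp add: A_def truncation_mat_def n_def)
  have trunc: "cinner (truncation N T x) y = cnj (cinner (truncation N T y) x)" for x y
  proof -
    have "cinner (truncation N T x) y = cinner x (truncation N T y)"
      using T fock_proj_selfadjoint[of N] unfolding selfadjoint_def is_cadjoint_def truncation_def comp_apply
      by metis
    also have "\<dots> = cnj (cinner (truncation N T y) x)"
      by (rule cinner_commute)
    finally show ?thesis .
  qed
  have herm: "A $$ (i, j) = cnj (A $$ (j, i))" if "i < n" "j < n" for i j
  proof -
    let ?e = "\<lambda>i. ket (word_enum N ! i) :: 'd fock"
    have "A $$ (i, j) = cinner (truncation N T (?e j)) (?e i)" "A $$ (j, i) = cinner (truncation N T (?e i)) (?e j)"
      using that by (simp_all add: A_def truncation_mat_def n_def)
    then show ?thesis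
      using trunc by metis
  qed
  obtain as where as: "char_poly A = (\<Prod>a\<leftarrow>as. [:- a, 1:])" "length as = n"
    using char_poly_factorized[OF A] by auto
  have real: "a \<in> \<real>" if "a \<in> set as" for a
  proof (rule hermitian_eigenvalue_real[OF A herm])
    have "poly (char_poly A) a = 0"
      unfolding as(1) using that by (induction as) auto
    then show "eigenvalue A a"
      by (simp add: eigenvalue_root_char_poly[OF A])
  qed
  have "char_poly A = (\<Prod>i<n. [:- (as ! i), 1:])"
    unfolding as(1) by (simp add: prod.list_conv_set_nth as(2) atLeast0LessThan)
  also have "\<dots> = (\<Prod>i=1..n. [:- (as ! (i - 1)), 1:])"
    by (rule prod.reindex_bij_witness[of _ "\<lambda>i. i - 1" Suc]) auto
  also have "\<dots> = (\<Prod>i=1..n. [:- complex_of_real (Re (as ! (i - 1))), 1:])"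
  proof (rule prod.cong[OF refl])
    fix i
    assume "i \<in> {1..n}"
    then have "as ! (i - 1) \<in> set as"
      using as(2) by (intro nth_mem) auto
    then show "[:- (as ! (i - 1)), 1:] = [:- complex_of_real (Re (as ! (i - 1))), 1:]"
      using real by (simp del: One_nat_def)
  qed
  finally have "truncation_eigenvalues N T (\<lambda>i. Re (as ! (i - 1)))"
    by (simp add: truncation_eigenvalues_def A_def n_def)
  then show ?thesis by blast
qed


section \<open>The limit of the eigenvalue distributions\<close>

text \<open>
  \<open>f\<close> need not be bounded, so its integrability is part of what the equation asserts (the Bochner
  integral of a non-integrable function is \<open>0\<close> by convention).
\<close>

definition eigenvalue_limit_measure :: "'d itself \<Rightarrow> (nat \<Rightarrow> nat \<Rightarrow> real) \<Rightarrow> real measure \<Rightarrow> bool" where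
  "eigenvalue_limit_measure D l \<mu> \<longleftrightarrow> real_distribution \<mu> \<and>
     (\<forall>f :: real \<Rightarrow> complex. continuous_on UNIV f \<longrightarrow> integrable \<mu> f \<and>
        (\<lambda>N. 1 / of_nat (fock_dim D N) * (\<Sum>i=1..fock_dim D N. f (l N i)))
          \<longlonglongrightarrow> (\<integral>x. f x \<partial>\<mu>))"

definition smallest_interval :: "complex set \<Rightarrow> real \<Rightarrow> real \<Rightarrow> bool" where
  "smallest_interval S a b \<longleftrightarrow> S \<subseteq> complex_of_real ` {a..b} \<and>
     (\<forall>c d. S \<subseteq> complex_of_real ` {c..d} \<longrightarrow> {a..b} \<subseteq> {c..d})"

end

theory Submission
  imports Defs "Jordan_Normal_Form.Schur_Decomposition"
begin

text \<open>
  The proof rests on the growth of the moments. Let \<open>t\<^sub>k(N)\<close> be the trace of \<open>T\<^sub>N\<^sup>k\<close>, that is the sum of the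
  \<open>k\<close>-th powers of the eigenvalues of \<open>T\<^sub>N\<close> (\<open>sum_eigenvalue_powers_eq_word_trace\<close>, by Schur
  triangularization). The nonempty words of length at most \<open>N + 1\<close> fall into \<open>d\<close> classes according to
  their last letter, and the multi-Toeplitz relation says precisely that the compression of \<open>T\<close> to
  these words is the direct sum of \<open>d\<close> copies of \<open>T\<^sub>N\<close> (\<open>drop_vacuum_truncation_right_shift\<close>). The
  truncation \<open>T\<^bsub>N+1\<^esub>\<close> itself involves only one further basis vector, the vacuum, so passing to the
  compression is a perturbation of bounded rank, and
  \<open>|t\<^sub>k(N + 1) - d t\<^sub>k(N)| \<le> (k + 1) K\<^sup>k\<close> for a bound \<open>K\<close> of the norm of \<open>T\<close>, with no dependence on \<open>N\<close>
  (\<open>word_trace_recursion\<close>). Since \<open>d\<^bsub>N+1\<^esub> = 1 + d d\<^sub>N\<close> grows exponentially when \<open>d \<ge> 2\<close>, the normalized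
  moments \<open>t\<^sub>k(N) / d\<^sub>N\<close> form a Cauchy sequence (\<open>convergent_eigenvalue_moments\<close>).

  All the eigenvalues lie in the fixed interval \<open>[-K, K]\<close>. Weierstrass approximation therefore turns
  convergence of moments into convergence of the averages of every continuous function, and Helly's
  selection theorem provides a measure whose integrals are the limits
  (\<open>ex_limit_of_empirical_distributions\<close>). It is unique because its characteristic function is
  determined (\<open>eigenvalue_limit_measure_unique\<close>).

  For the support, an eigenvalue of \<open>T\<^sub>N\<close> is a value \<open>\<langle>Tx, x\<rangle> / |x|\<^sup>2\<close> of the Rayleigh quotient of \<open>T\<close>
  itself. The infimum and the supremum of these quotients belong to the spectrum of \<open>T\<close>
  (\<open>numerical_range_lower_bound\<close>, \<open>numerical_range_upper_bound\<close>), so an interval that contains the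
  spectrum contains all the eigenvalues, and integrating the distance to this interval shows that
  the limit has no mass outside it (\<open>eigenvalue_limit_measure_support\<close>).
\<close>

section \<open>Power sums of eigenvalues as traces\<close>

lemma upper_triangular_pow:
  fixes A :: "'a :: comm_semiring_1 mat"
  assumes A: "A \<in> carrier_mat n n" and tri: "upper_triangular A"
  shows "(\<forall>i<n. \<forall>j<i. (A ^\<^sub>m k) $$ (i, j) = 0) \<and> (\<forall>i<n. (A ^\<^sub>m k) $$ (i, i) = A $$ (i, i) ^ k)"
proof (induction k)
  case 0
  then show ?case
    using A by auto
next
  case (Suc k)
  have entry: "(A ^\<^sub>m Suc k) $$ (i, j) = (\<Sum>m<n. (A ^\<^sub>m k) $$ (i, m) * A $$ (m, j))"
    if "i < n" "j < n" for i j
    using that A by (simp add: scalar_prod_def atLeast0LessThan)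
  have zero: "A $$ (i, j) = 0" if "j < i" "i < n" for i j
    using tri A that by (auto simp: upper_triangular_def)
  show ?case
  proof (intro conjI allI impI)
    fix i j assume ij: "i < n" "j < i"
    have "(A ^\<^sub>m k) $$ (i, m) * A $$ (m, j) = 0" if "m < n" for m
      using Suc.IH zero[of j m] that ij by (cases "m < i") auto
    then show "(A ^\<^sub>m Suc k) $$ (i, j) = 0"
      using ij by (simp add: entry del: pow_mat.simps)
  next
    fix i assume i: "i < n"
    have "(A ^\<^sub>m Suc k) $$ (i, i) = (\<Sum>m<n. if m = i then (A ^\<^sub>m k) $$ (i, m) * A $$ (m, i) else 0)"
      unfolding entry[OF i i]
    proof (rule sum.cong[OF refl])
      fix m assume "m \<in> {..<n}"
      then show "(A ^\<^sub>m k) $$ (i, m) * A $$ (m, i) = (if m = i then (A ^\<^sub>m k) $$ (i, m) * A $$ (m, i) else 0)"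
        using Suc.IH zero[of i m] i by (cases m i rule: linorder_cases) auto
    qed
    then show "(A ^\<^sub>m Suc k) $$ (i, i) = A $$ (i, i) ^ Suc k"
      using i Suc.IH by (simp add: sum.delta mult.commute del: pow_mat.simps)
  qed
qed

lemma sum_diag_mult_commute:
  fixes A B :: "'a :: comm_semiring_0 mat"
  assumes "A \<in> carrier_mat n m" "B \<in> carrier_mat m n"
  shows "(\<Sum>i<n. (A * B) $$ (i, i)) = (\<Sum>j<m. (B * A) $$ (j, j))"
proof -
  have "(\<Sum>i<n. (A * B) $$ (i, i)) = (\<Sum>i<n. \<Sum>j<m. A $$ (i, j) * B $$ (j, i))"
    using assms by (intro sum.cong refl) (simp add: scalar_prod_def atLeast0LessThan)
  also have "\<dots> = (\<Sum>j<m. \<Sum>i<n. B $$ (j, i) * A $$ (i, j))"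
    by (subst sum.swap) (simp add: mult.commute)
  also have "\<dots> = (\<Sum>j<m. (B * A) $$ (j, j))"
    using assms by (intro sum.cong refl) (simp add: scalar_prod_def atLeast0LessThan)
  finally show ?thesis .
qed

text \<open>
  Schur's triangularization: conjugation changes neither the trace nor the characteristic
  polynomial, and the diagonal of a power of a triangular matrix is the power of its diagonal.
\<close>

lemma trace_power_eq_sum_eigenvalue_powers:
  fixes A :: "complex mat" and l :: "nat \<Rightarrow> complex"
  assumes A: "A \<in> carrier_mat n n" and char: "char_poly A = (\<Prod>i=1..n. [:- l i, 1:])"
  shows "(\<Sum>i<n. (A ^\<^sub>m k) $$ (i, i)) = (\<Sum>i=1..n. l i ^ k)"
proof -
  define es where "es = map l [1..<Suc n]"
  have char': "char_poly A = (\<Prod>e\<leftarrow>es. [:- e, 1:])"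
    unfolding char es_def map_map comp_def
    by (simp only: prod.distinct_set_conv_list[OF distinct_upt, symmetric] set_upt
        atLeastLessThanSuc_atLeastAtMost)
  obtain B P Q where "schur_decomposition A es = (B, P, Q)"
    by (cases "schur_decomposition A es")
  from schur_decomposition[OF A char' this]
  have wit: "similar_mat_wit A B P Q" and tri: "upper_triangular B" and diag: "diag_mat B = es"
    by auto
  have "n = dim_row A"
    using A by simp
  note D = similar_mat_witD[OF this wit]
  have Bk: "B ^\<^sub>m k \<in> carrier_mat n n"
    using D(5) by simp
  have "B $$ (i, i) = l (Suc i)" if "i < n" for i
    using arg_cong[OF diag, of "\<lambda>xs. xs ! i"] that D(5)
    by (simp add: diag_mat_def es_def del: upt_Suc)
  then have "(B ^\<^sub>m k) $$ (i, i) = l (Suc i) ^ k" if "i < n" for i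
    using upper_triangular_pow[OF D(5) tri, of k] that by simp
  then have "(\<Sum>i<n. (B ^\<^sub>m k) $$ (i, i)) = (\<Sum>i<n. l (Suc i) ^ k)"
    by simp
  also have "\<dots> = (\<Sum>i=1..n. l i ^ k)"
    by (rule sum.reindex_bij_witness[of _ "\<lambda>i. i - 1" Suc]) auto
  finally have "(\<Sum>i<n. (B ^\<^sub>m k) $$ (i, i)) = (\<Sum>i=1..n. l i ^ k)" .
  moreover have "(\<Sum>i<n. (A ^\<^sub>m k) $$ (i, i)) = (\<Sum>i<n. (Q * (P * B ^\<^sub>m k)) $$ (i, i))"
    unfolding similar_mat_wit_pow_id[OF wit]
    by (rule sum_diag_mult_commute) (use D(6,7) Bk in auto)
  moreover have "Q * (P * B ^\<^sub>m k) = B ^\<^sub>m k"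
    using assoc_mult_mat[OF D(7,6) Bk] D(2) left_mult_one_mat[OF Bk] by simp
  ultimately show ?thesis
    by simp
qed


section \<open>Operators on square-summable families\<close>

lemma coord_sum: "coord (\<Sum>i\<in>I. x i) a = (\<Sum>i\<in>I. coord (x i) a)"
  by (induction I rule: infinite_finite_induct) simp_all

lemma coord_ket: "coord (ket b) a = (if a = b then 1 else 0)"
  by (simp add: ket.rep_eq)

lemma norm_ell2_le:
  assumes "\<And>a. cmod (coord x a) \<le> cmod (coord y a)"
  shows "norm x \<le> norm y"
  unfolding norm_ell2_def
  by (intro real_sqrt_le_mono infsum_mono coord_square_summable power_mono assms norm_ge_zero)

lemma cmod_coord_le_norm: "cmod (coord x a) \<le> norm x"
proof -
  have "(\<Sum>b\<in>{a}. (cmod (coord x b))\<^sup>2) \<le> (\<Sum>\<^sub>\<infinity>b. (cmod (coord x b))\<^sup>2)"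
    by (rule finite_sum_le_infsum) (auto simp: coord_square_summable)
  then show ?thesis
    unfolding norm_ell2_def by (intro real_le_rsqrt) simp
qed

lemma norm_ket: "norm (ket a) = 1"
proof -
  have "(\<Sum>\<^sub>\<infinity>b. (cmod (coord (ket a) b))\<^sup>2) = (\<Sum>\<^sub>\<infinity>b\<in>{a}. 1)"
    by (rule infsum_cong_neutral) (auto simp: coord_ket)
  then show ?thesis
    by (simp add: norm_ell2_def)
qed

lemma bounded_clinearD:
  assumes "bounded_clinear S"
  shows "bounded_linear S" "S (c *\<^sub>C x) = c *\<^sub>C S x" "S (x + y) = S x + S y"
    "S (x - y) = S x - S y" "S 0 = 0" "S (\<Sum>i\<in>I. f i) = (\<Sum>i\<in>I. S (f i))"
  using assms by (auto simp: bounded_clinear_def linear_simps bounded_linear.linear linear_sum)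

lemma bounded_clinear_comp:
  "bounded_clinear S \<Longrightarrow> bounded_clinear T \<Longrightarrow> bounded_clinear (S \<circ> T)"
  by (auto simp: bounded_clinear_def comp_def bounded_linear_compose)

lemma bounded_clinear_funpow: "bounded_clinear S \<Longrightarrow> bounded_clinear (S ^^ k)"
  by (induction k) (simp_all only: funpow.simps bounded_clinear_comp, simp add: bounded_clinear_def id_def)

text \<open>
  Real scalars act as complex ones, so complex homogeneity already contains the real
  homogeneity that boundedness over the reals asks for.
\<close>

lemma bounded_clinear_contraction:
  assumes "\<And>x y. S (x + y) = S x + S y" "\<And>c x. S (c *\<^sub>C x) = c *\<^sub>C S x" "\<And>x. norm (S x) \<le> norm x"
  shows "bounded_clinear S"
proof -
  have "r *\<^sub>R x = complex_of_real r *\<^sub>C x" for r and x :: "'a ell2"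
    by (rule ell2_eqI) simp
  then show ?thesis
    unfolding bounded_clinear_def using assms
    by (auto intro!: bounded_linear_intro[where K = 1])
qed

lemma norm_funpow_le:
  fixes S :: "'a::real_normed_vector \<Rightarrow> 'a"
  assumes "\<And>x. norm (S x) \<le> K * norm x" "0 \<le> K"
  shows "norm ((S ^^ k) x) \<le> K ^ k * norm x"
proof (induction k)
  case (Suc k)
  have "norm ((S ^^ Suc k) x) \<le> K * norm ((S ^^ k) x)"
    using assms(1) by simp
  also have "\<dots> \<le> K * (K ^ k * norm x)"
    using assms(2) Suc by (rule mult_left_mono[rotated])
  finally show ?case
    by simp
qed simp

lemma norm_fock_proj_le: "norm (fock_proj N x) \<le> norm x"
  by (rule norm_ell2_le) (simp add: fock_proj.rep_eq)

lemma bounded_clinear_fock_proj: "bounded_clinear (fock_proj N)"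
  by (rule bounded_clinear_contraction) (auto intro!: ell2_eqI simp: fock_proj.rep_eq norm_fock_proj_le)

lemma bounded_clinear_truncation: "bounded_clinear T \<Longrightarrow> bounded_clinear (truncation N T)"
  unfolding truncation_def by (intro bounded_clinear_comp bounded_clinear_fock_proj)

lemma norm_truncation_le:
  assumes "\<And>x. norm (T x) \<le> K * norm x" "0 \<le> K"
  shows "norm (truncation N T x) \<le> K * norm x"
proof -
  have "norm (truncation N T x) \<le> norm (T (fock_proj N x))"
    by (simp add: truncation_def norm_fock_proj_le)
  also have "\<dots> \<le> K * norm (fock_proj N x)"
    by (rule assms)
  also have "\<dots> \<le> K * norm x"
    by (intro mult_left_mono norm_fock_proj_le assms)
  finally show ?thesis .
qed


section \<open>Truncations and their matrices\<close>

lemma sum_word_enum: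
  "(\<Sum>i<fock_dim TYPE('d::finite) N. f (word_enum N ! i)) = (\<Sum>w :: 'd list | length w \<le> N. f w)"
  using sum.reindex_bij_betw[OF bij_betw_nth[OF word_enum(1) refl word_enum(2)[symmetric]], of f N]
  by (simp add: word_enum(3))

text \<open>
  Since the truncation maps into the span of the \<open>\<xi>\<^sub>v\<close> with \<open>|v| \<le> N\<close>, composing operators there is
  multiplying their matrices. This turns matrix traces into sums of diagonal coefficients over words,
  to which the shifts can be applied.
\<close>

lemma truncation_mat_pow:
  fixes T :: "'d::finite fock \<Rightarrow> 'd fock"
  assumes T: "bounded_clinear T" and i: "i < fock_dim TYPE('d) N" and j: "j < fock_dim TYPE('d) N"
  shows "(truncation_mat N T ^\<^sub>m k) $$ (i, j)
    = coord ((truncation N T ^^ k) (ket (word_enum N ! j))) (word_enum N ! i)"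
  using i j
proof (induction k arbitrary: i j)
  case 0
  then show ?case
    using nth_eq_iff_index_eq[OF word_enum(1)[of N, where ?'d = 'd]]
    by (auto simp: truncation_mat_def coord_ket word_enum(3))
next
  case (Suc k)
  let ?S = "truncation N T" and ?w = "\<lambda>m. word_enum N ! m :: 'd list" and ?n = "fock_dim TYPE('d) N"
  have proj: "?S x = fock_proj N (?S x)" for x
    by (rule ell2_eqI) (simp add: truncation_def fock_proj.rep_eq)
  have cl: "bounded_clinear (?S ^^ k)"
    by (intro bounded_clinear_funpow bounded_clinear_truncation T)
  have "(truncation_mat N T ^\<^sub>m Suc k) $$ (i, j)
      = (\<Sum>m<?n. (truncation_mat N T ^\<^sub>m k) $$ (i, m) * truncation_mat N T $$ (m, j))"
    using Suc.prems by (simp add: scalar_prod_def atLeast0LessThan truncation_mat_def)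
  also have "\<dots> = (\<Sum>m<?n. coord ((?S ^^ k) (ket (?w m))) (?w i) * coord (?S (ket (?w j))) (?w m))"
    using Suc by (intro sum.cong refl) (simp add: truncation_mat_def cinner_ket_right)
  also have "\<dots> = (\<Sum>v | length v \<le> N. coord ((?S ^^ k) (ket v)) (?w i) * coord (?S (ket (?w j))) v)"
    by (rule sum_word_enum)
  also have "\<dots> = coord ((?S ^^ k) (fock_proj N (?S (ket (?w j))))) (?w i)"
    by (simp add: fock_proj_eq_sum bounded_clinearD[OF cl] coord_sum cinner_ket_right mult.commute)
  finally show ?case
    by (simp add: proj[symmetric] funpow_swap1)
qed

text \<open>
  The trace of the compression of \<open>S\<close> to the words of length at most \<open>N\<close>. On powers of the truncation,
  the zeroth power included, it is the trace of the corresponding matrix power.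
\<close>

definition word_trace :: "nat \<Rightarrow> ('d::finite fock \<Rightarrow> 'd fock) \<Rightarrow> complex" where
  "word_trace N S = (\<Sum>w | length w \<le> N. coord (S (ket w)) w)"

lemma sum_eigenvalue_powers_eq_word_trace:
  fixes T :: "'d::finite fock \<Rightarrow> 'd fock"
  assumes T: "bounded_clinear T" and l: "truncation_eigenvalues N T l"
  shows "complex_of_real (\<Sum>i=1..fock_dim TYPE('d) N. l i ^ k) = word_trace N (truncation N T ^^ k)"
proof -
  let ?n = "fock_dim TYPE('d) N" and ?A = "truncation_mat N T"
  have "?A \<in> carrier_mat ?n ?n"
    by (simp add: truncation_mat_def)
  from trace_power_eq_sum_eigenvalue_powers[OF this, of "\<lambda>i. complex_of_real (l i)" k] l
  have "complex_of_real (\<Sum>i=1..?n. l i ^ k) = (\<Sum>i<?n. (?A ^\<^sub>m k) $$ (i, i))"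
    by (simp add: truncation_eigenvalues_def)
  also have "\<dots> = (\<Sum>i<?n. coord ((truncation N T ^^ k) (ket (word_enum N ! i))) (word_enum N ! i))"
    by (intro sum.cong refl truncation_mat_pow[OF T]) auto
  also have "\<dots> = word_trace N (truncation N T ^^ k)"
    unfolding word_trace_def by (rule sum_word_enum)
  finally show ?thesis .
qed


section \<open>The trace recursion for multi-Toeplitz operators\<close>

definition drop_vacuum :: "'d fock \<Rightarrow> 'd fock" where
  "drop_vacuum x = x - coord x [] *\<^sub>C ket []"

lemma coord_drop_vacuum: "coord (drop_vacuum x) w = (if w = [] then 0 else coord x w)"
  by (simp add: drop_vacuum_def coord_ket)

lemma norm_drop_vacuum_le: "norm (drop_vacuum x) \<le> norm x"
  by (rule norm_ell2_le) (simp add: coord_drop_vacuum)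

lemma bounded_clinear_drop_vacuum: "bounded_clinear drop_vacuum"
  by (rule bounded_clinear_contraction)
    (auto intro!: ell2_eqI simp: coord_drop_vacuum norm_drop_vacuum_le)

text \<open>
  Every nonempty word is \<open>v i\<close> for exactly one letter \<open>i\<close>, so the nonempty words
  of length at most \<open>N + 1\<close> form \<open>d\<close> copies of the words of length at most \<open>N\<close>. The relation
  \<open>R\<^sub>j\<^sup>* T R\<^sub>i = \<delta>\<^sub>i\<^sub>j T\<close> says that \<open>T\<close> does not mix the copies and acts on each of them as on the original,
  as long as the coefficient at the empty word is discarded.
\<close>

lemma drop_vacuum_truncation_right_shift:
  fixes T :: "'d::finite fock \<Rightarrow> 'd fock"
  assumes "multi_toeplitz T"
  shows "(drop_vacuum \<circ> truncation (Suc N) T) (right_shift i x) = right_shift i (truncation N T x)"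
proof (rule ell2_eqI)
  fix w :: "'d list"
  have comm: "fock_proj (Suc N) (right_shift i x) = right_shift i (fock_proj N x)"
    by (rule ell2_eqI) (auto simp: fock_proj.rep_eq right_shift.rep_eq)
  have toeplitz: "coord (T (right_shift i y)) (v @ [j]) = (if j = i then coord (T y) v else 0)" for y v j
  proof -
    have "coord (T (right_shift i y)) (v @ [j]) = coord (right_annihilate j (T (right_shift i y))) v"
      by (simp add: right_annihilate.rep_eq)
    moreover have "right_annihilate j \<circ> T \<circ> right_shift i = (if j = i then T else (\<lambda>_. 0))"
      using assms unfolding multi_toeplitz_def cadjoint_right_shift by blast
    from fun_cong[OF this, of y]
    have "right_annihilate j (T (right_shift i y)) = (if j = i then T y else 0)"
      by (simp add: if_distribR)
    ultimately show ?thesis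
      by simp
  qed
  show "coord ((drop_vacuum \<circ> truncation (Suc N) T) (right_shift i x)) w
      = coord (right_shift i (truncation N T x)) w"
    by (cases w rule: rev_cases)
      (auto simp: coord_drop_vacuum truncation_def comm toeplitz fock_proj.rep_eq right_shift.rep_eq)
qed

lemma funpow_drop_vacuum_truncation_right_shift:
  fixes T :: "'d::finite fock \<Rightarrow> 'd fock"
  assumes "multi_toeplitz T"
  shows "((drop_vacuum \<circ> truncation (Suc N) T) ^^ k) (right_shift i x)
    = right_shift i ((truncation N T ^^ k) x)"
proof (induction k)
  case (Suc k)
  then show ?case
    using drop_vacuum_truncation_right_shift[OF assms, of N i "(truncation N T ^^ k) x"] by simp
qed simp

lemma sum_words_Suc:
  fixes f :: "'d::finite list \<Rightarrow> complex"
  shows "(\<Sum>w | length w \<le> Suc N. f w) = f [] + (\<Sum>i\<in>UNIV. \<Sum>v | length v \<le> N. f (v @ [i]))"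
proof -
  have fin: "finite {v :: 'd list. length v \<le> M}" for M
    using finite_lists_length_le[of "UNIV :: 'd set" M] by simp
  have split: "{w :: 'd list. length w \<le> Suc N} = insert [] ((\<lambda>(i, v). v @ [i]) ` (UNIV \<times> {v. length v \<le> N}))"
  proof (rule Set.set_eqI)
    fix w :: "'d list"
    show "w \<in> {w. length w \<le> Suc N} \<longleftrightarrow> w \<in> insert [] ((\<lambda>(i, v). v @ [i]) ` (UNIV \<times> {v. length v \<le> N}))"
      by (cases w rule: rev_cases) auto
  qed
  have inj: "inj_on (\<lambda>(i, v). v @ [i]) (UNIV \<times> {v :: 'd list. length v \<le> N})"
    by (auto simp: inj_on_def)
  have "(\<Sum>w | length w \<le> Suc N. f w) = f [] + (\<Sum>w\<in>(\<lambda>(i, v). v @ [i]) ` (UNIV \<times> {v. length v \<le> N}). f w)"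
    unfolding split using fin by (subst sum.insert) auto
  also have "(\<Sum>w\<in>(\<lambda>(i, v). v @ [i]) ` (UNIV \<times> {v. length v \<le> N}). f w)
      = (\<Sum>i\<in>UNIV. \<Sum>v | length v \<le> N. f (v @ [i]))"
    by (subst sum.reindex[OF inj]) (simp add: sum.cartesian_product comp_def case_prod_unfold)
  finally show ?thesis .
qed

lemma fock_dim_Suc: "fock_dim D (Suc N) = 1 + CARD('d) * fock_dim (D :: 'd itself) N"
  by (simp add: fock_dim_def sum.atMost_Suc_shift sum_distrib_left del: sum.atMost_Suc)

lemma fock_dim_pos: "0 < fock_dim (D :: 'd::finite itself) N"
  by (induction N) (simp_all add: fock_dim_def)

text \<open>
  The diagonal coefficient at \<open>v i\<close> of the power equals the one at \<open>v\<close> of the power of the smaller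
  truncation, for each of the \<open>d\<close> letters \<open>i\<close>; only the empty word remains.
\<close>

lemma word_trace_drop_vacuum:
  fixes T :: "'d::finite fock \<Rightarrow> 'd fock"
  assumes "multi_toeplitz T"
  shows "word_trace (Suc N) ((drop_vacuum \<circ> truncation (Suc N) T) ^^ k)
    = coord (((drop_vacuum \<circ> truncation (Suc N) T) ^^ k) (ket [])) []
      + of_nat CARD('d) * word_trace N (truncation N T ^^ k)"
proof -
  have "coord (((drop_vacuum \<circ> truncation (Suc N) T) ^^ k) (ket (v @ [i]))) (v @ [i])
      = coord ((truncation N T ^^ k) (ket v)) v" for v and i :: 'd
    by (simp add: funpow_drop_vacuum_truncation_right_shift[OF assms] right_shift.rep_eq
        flip: right_shift_ket)
  then show ?thesis
    by (simp add: word_trace_def sum_words_Suc)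
qed

lemma funpow_diff_eq_sum:
  fixes S G :: "'a::ab_group_add \<Rightarrow> 'a"
  assumes G: "\<And>x y. G (x - y) = G x - G y" "\<And>x y. G (x + y) = G x + G y"
  shows "(S ^^ k) x - (G ^^ k) x
    = (\<Sum>j<k. (G ^^ j) (S ((S ^^ (k - Suc j)) x) - G ((S ^^ (k - Suc j)) x)))"
proof (induction k)
  case (Suc k)
  have "G 0 = 0"
    using G(1)[of 0 0] by simp
  then have G_sum: "G (\<Sum>j\<in>J. f j) = (\<Sum>j\<in>J. G (f j))" for f :: "nat \<Rightarrow> 'a" and J
    by (induction J rule: infinite_finite_induct) (simp_all add: G(2))
  have "(S ^^ Suc k) x - (G ^^ Suc k) x
      = (S ((S ^^ k) x) - G ((S ^^ k) x)) + G ((S ^^ k) x - (G ^^ k) x)"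
    by (simp add: G(1))
  also have "\<dots> = (\<Sum>j<Suc k. (G ^^ j) (S ((S ^^ (Suc k - Suc j)) x) - G ((S ^^ (Suc k - Suc j)) x)))"
    unfolding Suc.IH G_sum by (subst sum.lessThan_Suc_shift) simp
  finally show ?case .
qed simp

text \<open>
  The difference \<open>S - drop_vacuum \<circ> S\<close> has rank at most one, with range in the span of the vacuum vector.
  Hence in the telescoping sum for \<open>S\<^sup>k - (drop_vacuum \<circ> S)\<^sup>k\<close> every summand has rank at most one, and the trace
  of its compression is a single matrix coefficient of a product of \<open>k\<close> operators of norm at most \<open>K\<close> and
  a projection. The bound is therefore independent of \<open>N\<close>.
\<close>

lemma word_trace_drop_vacuum_diff:
  fixes S :: "'d::finite fock \<Rightarrow> 'd fock" and K :: real
  assumes S: "bounded_clinear S" and bound: "\<And>x. norm (S x) \<le> K * norm x" "0 \<le> K"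
  shows "cmod (word_trace N (S ^^ k) - word_trace N ((drop_vacuum \<circ> S) ^^ k)) \<le> k * K ^ k"
proof -
  let ?G = "drop_vacuum \<circ> S"
  have G: "bounded_clinear ?G"
    by (intro bounded_clinear_comp bounded_clinear_drop_vacuum S)
  have Gk: "bounded_clinear (?G ^^ j)" and Sk: "bounded_clinear (S ^^ j)" for j
    by (intro bounded_clinear_funpow G S)+
  have G_bound: "norm (?G x) \<le> K * norm x" for x
    using norm_drop_vacuum_le[of "S x"] bound(1)[of x] by simp
  have diff: "(S ^^ k) x - (?G ^^ k) x = (\<Sum>j<k. coord ((S ^^ (k - j)) x) [] *\<^sub>C (?G ^^ j) (ket []))" for x
  proof -
    have "(?G ^^ j) (S ((S ^^ (k - Suc j)) x) - ?G ((S ^^ (k - Suc j)) x))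
        = coord ((S ^^ (k - j)) x) [] *\<^sub>C (?G ^^ j) (ket [])" if "j < k" for j
    proof -
      have power: "S ((S ^^ (k - Suc j)) x) = (S ^^ (k - j)) x"
        using that by (metis Suc_diff_Suc comp_apply funpow.simps(2))
      have vacuum: "S y - ?G y = coord (S y) [] *\<^sub>C ket []" for y
        by (simp add: drop_vacuum_def)
      show ?thesis
        unfolding vacuum bounded_clinearD(2)[OF Gk] by (simp only: power)
    qed
    then show ?thesis
      by (subst funpow_diff_eq_sum[OF bounded_clinearD(4,3)[OF G]]) (intro sum.cong refl, simp)
  qed
  have "coord ((S ^^ k) x) w - coord ((?G ^^ k) x) w
      = (\<Sum>j<k. coord ((S ^^ (k - j)) x) [] * coord ((?G ^^ j) (ket [])) w)" for x w
    using arg_cong[OF diff, of "\<lambda>y. coord y w"] by (simp only: coord_simps coord_sum)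
  then have "word_trace N (S ^^ k) - word_trace N (?G ^^ k)
      = (\<Sum>w | length w \<le> N. \<Sum>j<k. coord ((S ^^ (k - j)) (ket w)) [] * coord ((?G ^^ j) (ket [])) w)"
    by (simp add: word_trace_def flip: sum_subtractf)
  also have "\<dots> = (\<Sum>j<k. coord ((S ^^ (k - j)) (fock_proj N ((?G ^^ j) (ket [])))) [])"
    by (subst sum.swap)
      (simp add: fock_proj_eq_sum bounded_clinearD[OF Sk] coord_sum cinner_ket_right mult.commute)
  also have "cmod \<dots> \<le> (\<Sum>j<k. K ^ k)"
  proof (intro order.trans[OF norm_sum] sum_mono)
    fix j assume "j \<in> {..<k}"
    then have "K ^ k = K ^ (k - j) * K ^ j"
      by (simp flip: power_add)
    let ?y = "(?G ^^ j) (ket [])"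
    have "cmod (coord ((S ^^ (k - j)) (fock_proj N ?y)) []) \<le> K ^ (k - j) * norm (fock_proj N ?y)"
      by (rule order.trans[OF cmod_coord_le_norm norm_funpow_le[OF bound]])
    also have "\<dots> \<le> K ^ (k - j) * norm ?y"
      by (intro mult_left_mono norm_fock_proj_le zero_le_power bound)
    also have "\<dots> \<le> K ^ (k - j) * (K ^ j * norm (ket [] :: 'd fock))"
      by (intro mult_left_mono norm_funpow_le[OF G_bound] zero_le_power bound)
    finally show "cmod (coord ((S ^^ (k - j)) (fock_proj N ?y)) []) \<le> K ^ k"
      using \<open>K ^ k = _\<close> by (simp only: norm_ket mult_1_right)
  qed
  finally show ?thesis
    by simp
qed

lemma word_trace_recursion:
  fixes T :: "'d::finite fock \<Rightarrow> 'd fock" and K :: real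
  assumes T: "bounded_clinear T" "multi_toeplitz T"
    and bound: "\<And>x. norm (T x) \<le> K * norm x" "0 \<le> K"
  shows "cmod (word_trace (Suc N) (truncation (Suc N) T ^^ k)
    - of_nat CARD('d) * word_trace N (truncation N T ^^ k)) \<le> (k + 1) * K ^ k"
proof -
  let ?S = "truncation (Suc N) T"
  let ?G = "drop_vacuum \<circ> ?S"
  have S_bound: "norm (?S x) \<le> K * norm x" for x
    by (rule norm_truncation_le[OF bound])
  have G_bound: "norm (?G x) \<le> K * norm x" for x
    using norm_drop_vacuum_le[of "?S x"] S_bound[of x] by simp
  have "cmod (coord ((?G ^^ k) (ket [])) []) \<le> K ^ k * norm (ket [] :: 'd fock)"
    by (rule order.trans[OF cmod_coord_le_norm norm_funpow_le[OF G_bound bound(2)]])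
  then have "cmod (coord ((?G ^^ k) (ket [])) []) \<le> K ^ k"
    by (simp only: norm_ket mult_1_right)
  moreover have "cmod (word_trace (Suc N) (?S ^^ k) - word_trace (Suc N) (?G ^^ k)) \<le> k * K ^ k"
    by (rule word_trace_drop_vacuum_diff[OF bounded_clinear_truncation[OF T(1)] S_bound bound(2)])
  ultimately show ?thesis
    using norm_triangle_ineq[of "word_trace (Suc N) (?S ^^ k) - word_trace (Suc N) (?G ^^ k)"
        "coord ((?G ^^ k) (ket [])) []"]
    by (simp add: word_trace_drop_vacuum[OF T(2)] algebra_simps)
qed

lemma cmod_word_trace_le:
  fixes T :: "'d::finite fock \<Rightarrow> 'd fock" and K :: real
  assumes bound: "\<And>x. norm (T x) \<le> K * norm x" "0 \<le> K"
  shows "cmod (word_trace N (truncation N T ^^ k)) \<le> real (fock_dim TYPE('d) N) * K ^ k"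
proof -
  have "cmod (coord ((truncation N T ^^ k) (ket w)) w) \<le> K ^ k * norm (ket w)" for w
    by (rule order.trans[OF cmod_coord_le_norm norm_funpow_le[OF norm_truncation_le[OF bound] bound(2)]])
  then have "cmod (word_trace N (truncation N T ^^ k)) \<le> (\<Sum>w :: 'd list | length w \<le> N. K ^ k)"
    unfolding word_trace_def norm_ket mult_1_right by (intro order.trans[OF norm_sum] sum_mono)
  then show ?thesis
    by (simp add: card_words)
qed

text \<open>
  Since \<open>t (N + 1) = d t N + O(1)\<close>, \<open>n (N + 1) = d n N + 1\<close> and \<open>t N / n N\<close> is bounded, consecutive
  quotients differ by \<open>O(1 / n (N + 1))\<close>. As \<open>n N \<ge> 2\<^sup>N\<close>, these changes are summable.
\<close>

lemma convergent_of_almost_geometric: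
  fixes t :: "nat \<Rightarrow> real" and n :: "nat \<Rightarrow> nat" and B C :: real
  assumes d: "2 \<le> d" and n0: "0 < n 0" and n: "\<And>N. n (Suc N) = 1 + d * n N"
    and rec: "\<And>N. \<bar>t (Suc N) - d * t N\<bar> \<le> C" and bound: "\<And>N. \<bar>t N\<bar> \<le> B * n N"
  shows "convergent (\<lambda>N. t N / n N)"
proof -
  have pos: "0 < n N" for N
    by (induction N) (simp_all add: n0 n)
  have pow: "2 ^ N \<le> n N" for N
  proof (induction N)
    case (Suc N)
    have "2 * n N \<le> d * n N"
      using d by simp
    then show ?case
      using Suc unfolding n power_Suc by linarith
  qed (use n0 in simp)
  have diff: "norm (t (Suc N) / n (Suc N) - t N / n N) \<le> (C + B) * (1 / 2) ^ N" for N
  proof -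
    have "t (Suc N) / n (Suc N) - t N / n N = ((t (Suc N) - d * t N) - t N / n N) / n (Suc N)"
    proof -
      define q where "q = t N / n N"
      have "t N = q * n N"
        using pos[of N] by (simp add: q_def)
      moreover have "real (n (Suc N)) = 1 + d * n N" "0 < 1 + real d * n N"
        by (simp_all add: n add_pos_nonneg)
      ultimately show ?thesis
        unfolding q_def[symmetric] by (simp add: divide_simps) (simp add: algebra_simps)
    qed
    moreover have "\<bar>t N / n N\<bar> \<le> B"
      using bound[of N] pos[of N] by (simp add: field_simps)
    then have "\<bar>(t (Suc N) - d * t N) - t N / n N\<bar> \<le> C + B"
      using rec[of N] by linarith
    ultimately have "norm (t (Suc N) / n (Suc N) - t N / n N) \<le> (C + B) / n (Suc N)"
      by (simp add: divide_right_mono)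
    also have "\<dots> \<le> (C + B) / 2 ^ N"
    proof (rule divide_left_mono)
      have "2 ^ N \<le> n (Suc N)"
        using pow[of "Suc N"] by simp
      then show "(2::real) ^ N \<le> n (Suc N)"
        by (metis of_nat_le_iff of_nat_numeral of_nat_power)
      show "0 \<le> C + B"
        using rec[of 0] \<open>\<bar>t N / n N\<bar> \<le> B\<close> by linarith
    qed (use pos in simp)
    finally show ?thesis
      by (simp add: power_one_over)
  qed
  have "summable (\<lambda>N. (C + B) * (1 / 2) ^ N)"
    by (intro summable_mult summable_geometric) simp
  then have "summable (\<lambda>N. t (Suc N) / n (Suc N) - t N / n N)"
    by (rule summable_comparison_test') (rule diff)
  then obtain s where "(\<lambda>m. \<Sum>N<m. t (Suc N) / n (Suc N) - t N / n N) \<longlonglongrightarrow> s"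
    by (auto simp: summable_def sums_def)
  then have "(\<lambda>m. t m / n m - t 0 / n 0) \<longlonglongrightarrow> s"
    by (simp only: sum_lessThan_telescope[of "\<lambda>N. t N / n N"])
  from tendsto_add[OF this tendsto_const[of "t 0 / n 0"]] show ?thesis
    by (auto simp: convergent_def)
qed

lemma convergent_eigenvalue_moments:
  fixes T :: "'d::finite fock \<Rightarrow> 'd fock"
  assumes d: "CARD('d) \<ge> 2" and T: "bounded_clinear T" "multi_toeplitz T"
    and l: "\<And>N. truncation_eigenvalues N T (l N)"
  shows "convergent (\<lambda>N. (\<Sum>i=1..fock_dim TYPE('d) N. l N i ^ k) / fock_dim TYPE('d) N)"
proof -
  obtain K where K: "0 \<le> K" "\<And>x. norm (T x) \<le> K * norm x"
    using bounded_linear.nonneg_bounded[OF bounded_clinearD(1)[OF T(1)]] by (metis mult.commute)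
  define t where "t N = (\<Sum>i=1..fock_dim TYPE('d) N. l N i ^ k)" for N
  have t: "complex_of_real (t N) = word_trace N (truncation N T ^^ k)" for N
    unfolding t_def by (rule sum_eigenvalue_powers_eq_word_trace[OF T(1) l])
  have rec: "\<bar>t (Suc N) - CARD('d) * t N\<bar> \<le> (real k + 1) * K ^ k" for N
  proof -
    have "complex_of_real (t (Suc N) - CARD('d) * t N) = word_trace (Suc N) (truncation (Suc N) T ^^ k)
        - of_nat CARD('d) * word_trace N (truncation N T ^^ k)"
      by (simp add: t)
    then show ?thesis
      using word_trace_recursion[OF T K(2,1), of N k] by (metis norm_of_real)
  qed
  have bound: "\<bar>t N\<bar> \<le> K ^ k * fock_dim TYPE('d) N" for N
    using cmod_word_trace_le[OF K(2,1), of N k] unfolding t[symmetric] norm_of_real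
    by (simp only: mult.commute)
  have "convergent (\<lambda>N. t N / fock_dim TYPE('d) N)"
    by (rule convergent_of_almost_geometric[where n = "fock_dim TYPE('d)" and t = t,
          OF d fock_dim_pos fock_dim_Suc rec bound])
  then show ?thesis
    by (simp add: t_def)
qed


section \<open>The numerical range and the spectrum\<close>

lemma positive_form_Cauchy_Schwarz:
  fixes A :: "'a::real_inner \<Rightarrow> 'a"
  assumes lin: "linear A" and symm: "\<And>x y. inner (A x) y = inner x (A y)"
    and pos: "\<And>x. 0 \<le> inner (A x) x"
  shows "(inner (A x) y)\<^sup>2 \<le> inner (A x) x * inner (A y) y"
proof -
  have expand: "inner (A (x + s *\<^sub>R y)) (x + s *\<^sub>R y)
      = inner (A x) x + 2 * s * inner (A x) y + s\<^sup>2 * inner (A y) y" for s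
    by (simp add: linear_add[OF lin] linear_scale[OF lin] inner_add_left inner_add_right symm[of y x]
        inner_commute[of y "A x"] power2_eq_square algebra_simps)
  show ?thesis
  proof (cases "inner (A y) y = 0")
    case True
    have "inner (A x) y = 0"
    proof (rule ccontr)
      assume "inner (A x) y \<noteq> 0"
      \<comment> \<open>At this \<open>s\<close> the quadratic form in \<open>expand\<close> would take the value \<open>-1\<close>.\<close>
      define s where "s = - (inner (A x) x + 1) / (2 * inner (A x) y)"
      with \<open>inner (A x) y \<noteq> 0\<close> have "2 * s * inner (A x) y = - (inner (A x) x + 1)"
        by simp
      then show False
        using pos[of "x + s *\<^sub>R y"] True unfolding expand by simp
    qed
    then show ?thesis
      using True by simp
  next
    case False
    then have "0 < inner (A y) y"
      using pos[of y] by simp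
    \<comment> \<open>\<open>s = - \<langle>Ax, y\<rangle> / \<langle>Ay, y\<rangle>\<close> minimizes the quadratic polynomial.\<close>
    then show ?thesis
      using pos[of "x + (- inner (A x) y / inner (A y) y) *\<^sub>R y"] unfolding expand
      by (simp add: field_simps power2_eq_square)
  qed
qed

text \<open>
  The inequality \<open>|Ax|\<^sup>4 = \<langle>Ax, Ax\<rangle>\<^sup>2 \<le> \<langle>Ax, x\<rangle> \<langle>AAx, Ax\<rangle>\<close> gives \<open>|Ax|\<^sup>2 \<le> |A| \<langle>Ax, x\<rangle>\<close>, and \<open>|x| \<le> |S| |Ax|\<close>
  because \<open>S\<close> is a left inverse of \<open>A\<close>.
\<close>

lemma positive_operator_coercive:
  fixes A S :: "'a::real_inner \<Rightarrow> 'a"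
  assumes A: "bounded_linear A" and S: "bounded_linear S" and inverse: "\<And>x. S (A x) = x"
    and symm: "\<And>x y. inner (A x) y = inner x (A y)" and pos: "\<And>x. 0 \<le> inner (A x) x"
  obtains c where "0 < c" "\<And>x. c * (norm x)\<^sup>2 \<le> inner (A x) x"
proof -
  obtain K where K: "0 < K" "\<And>x. norm (A x) \<le> norm x * K"
    using bounded_linear.pos_bounded[OF A] by blast
  obtain L where L: "0 < L" "\<And>x. norm (S x) \<le> norm x * L"
    using bounded_linear.pos_bounded[OF S] by blast
  have "(norm (A x))\<^sup>2 \<le> K * inner (A x) x" for x
  proof (cases "A x = 0")
    case False
    have "(norm (A x))\<^sup>2 * (norm (A x))\<^sup>2 = (inner (A x) (A x))\<^sup>2"
      by (simp add: dot_square_norm power2_eq_square)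
    also have "\<dots> \<le> inner (A x) x * inner (A (A x)) (A x)"
      by (rule positive_form_Cauchy_Schwarz[OF bounded_linear.linear[OF A] symm pos])
    also have "\<dots> \<le> inner (A x) x * (K * (norm (A x))\<^sup>2)"
    proof (intro mult_left_mono pos)
      have "inner (A (A x)) (A x) \<le> norm (A (A x)) * norm (A x)"
        by (rule norm_cauchy_schwarz)
      also have "\<dots> \<le> norm (A x) * K * norm (A x)"
        by (intro mult_right_mono K norm_ge_zero)
      finally show "inner (A (A x)) (A x) \<le> K * (norm (A x))\<^sup>2"
        by (simp add: power2_eq_square mult_ac)
    qed
    finally have "(norm (A x))\<^sup>2 * (norm (A x))\<^sup>2 \<le> (K * inner (A x) x) * (norm (A x))\<^sup>2"
      by (simp only: mult_ac)
    then show ?thesis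
      by (rule mult_right_le_imp_le) (use False in simp)
  qed (use K pos in simp)
  moreover have "(norm x)\<^sup>2 \<le> L\<^sup>2 * (norm (A x))\<^sup>2" for x
    using power_mono[OF L(2)[of "A x"], of 2] by (simp add: inverse power_mult_distrib mult.commute)
  ultimately have "(norm x)\<^sup>2 \<le> L\<^sup>2 * (K * inner (A x) x)" for x
    using L(1) by (meson mult_left_mono order.trans zero_le_power2)
  then have "1 / (L\<^sup>2 * K) * (norm x)\<^sup>2 \<le> inner (A x) x" for x
    using K(1) L(1) by (simp add: field_simps)
  then show ?thesis
    using K(1) L(1) by (intro that[of "1 / (L\<^sup>2 * K)"]) auto
qed

text \<open>
  The infimum \<open>m\<close> of the numerical range lies in the spectrum: otherwise the positive operator \<open>T - m\<close>
  would be invertible, hence coercive, and \<open>m\<close> could be increased. So \<open>a \<le> m\<close>. The argument also shows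
  that the spectrum is not empty.
\<close>

lemma numerical_range_lower_bound:
  fixes T :: "'a ell2 \<Rightarrow> 'a ell2"
  assumes T: "bounded_clinear T" "selfadjoint T" and spec: "op_spectrum T \<subseteq> complex_of_real ` {a..b}"
  shows "a * (norm x)\<^sup>2 \<le> inner (T x) x"
proof -
  let ?W = "(\<lambda>x. inner (T x) x) ` {x. norm x = 1}"
  define m where "m = Inf ?W"
  note bl = bounded_clinearD(1)[OF T(1)]
  obtain K where K: "\<And>x. norm (T x) \<le> norm x * K"
    using bounded_linear.bounded[OF bl] by blast
  have "ket undefined \<in> {x :: 'a ell2. norm x = 1}"
    by (simp add: norm_ket)
  then have ne: "?W \<noteq> {}"
    by auto
  have bdd: "bdd_below ?W"
  proof (rule bdd_belowI2)
    fix x :: "'a ell2" assume "x \<in> {x. norm x = 1}"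
    then show "- K \<le> inner (T x) x"
      using Cauchy_Schwarz_ineq2[of "T x" x] K[of x] by simp
  qed
  have m: "m * (norm x)\<^sup>2 \<le> inner (T x) x" for x
  proof (cases "x = 0")
    case False
    let ?u = "x /\<^sub>R norm x"
    have "m \<le> inner (T ?u) ?u"
      unfolding m_def by (rule cInf_lower[OF imageI bdd]) (use False in simp)
    also have "\<dots> = inner (T x) x / (norm x)\<^sup>2"
      by (simp add: linear_simps[OF bl] power2_eq_square divide_inverse)
    finally show ?thesis
      using False by (simp add: field_simps)
  qed (simp add: linear_simps[OF bl])
  have "complex_of_real m \<in> op_spectrum T"
  proof (rule ccontr)
    define A where "A x = T x - m *\<^sub>R x" for x
    have A_alt: "A x = T x - complex_of_real m *\<^sub>C x" for x
      unfolding A_def by (rule ell2_eqI) simp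
    assume "complex_of_real m \<notin> op_spectrum T"
    then obtain S where S: "bounded_clinear S" "\<And>x. S (A x) = x"
      unfolding op_spectrum_def A_alt by blast
    have symm: "inner (A x) y = inner x (A y)" for x y
      using T(2) by (simp add: A_def inner_diff_left inner_diff_right inner_ell2_def[of "T x"]
          inner_ell2_def[of x "T y"] selfadjoint_def is_cadjoint_def)
    have inner_A: "inner (A x) x = inner (T x) x - m * (norm x)\<^sup>2" for x
      by (simp add: A_def inner_diff_left power2_norm_eq_inner)
    have "bounded_linear A"
      unfolding A_def by (intro bounded_linear_sub bl bounded_linear_scaleR_right)
    moreover have "0 \<le> inner (A x) x" for x
      using m[of x] by (simp only: inner_A diff_ge_0_iff_ge)
    ultimately obtain c where c: "0 < c" "\<And>x. c * (norm x)\<^sup>2 \<le> inner (A x) x"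
      using positive_operator_coercive[OF _ bounded_clinearD(1)[OF S(1)] S(2) symm] by metis
    have "m + c \<le> Inf ?W"
    proof (rule cInf_greatest[OF ne])
      fix r assume "r \<in> ?W"
      then obtain x where "norm x = 1" "r = inner (T x) x"
        by auto
      then show "m + c \<le> r"
        using c(2)[of x] inner_A[of x] by simp
    qed
    with c(1) show False
      by (simp add: m_def)
  qed
  with spec have "a \<le> m"
    by auto
  then show ?thesis
    using m[of x] by (meson mult_right_mono order.trans zero_le_power2)
qed

lemma op_spectrum_uminus: "op_spectrum (\<lambda>x. - T x) \<subseteq> uminus ` op_spectrum T"
proof
  fix z assume z: "z \<in> op_spectrum (\<lambda>x. - T x)"
  have "- z \<in> op_spectrum T"
  proof (rule ccontr)
    assume "- z \<notin> op_spectrum T"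
    then obtain S where S: "bounded_clinear S" "\<And>x. S (T x - (- z) *\<^sub>C x) = x"
      "\<And>x. T (S x) - (- z) *\<^sub>C S x = x"
      unfolding op_spectrum_def by blast
    note lin = bounded_clinearD[OF S(1)]
    have neg: "(- z) *\<^sub>C x = - (z *\<^sub>C x)" for x :: "'a ell2"
      by (rule ell2_eqI) simp
    have S_neg: "S (- x) = - S x" for x
      using lin(4)[of 0 x] lin(5) by simp
    have neg': "c *\<^sub>C (- x) = - (c *\<^sub>C x)" for c and x :: "'a ell2"
      by (rule ell2_eqI) simp
    have "bounded_clinear (\<lambda>x. - S x)"
      using S(1) by (auto simp: bounded_clinear_def bounded_linear_minus neg')
    moreover have "- S (- T x - z *\<^sub>C x) = x" for x
      using S(2)[of x] S_neg[of "T x + z *\<^sub>C x"] by (simp add: neg)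
    moreover have "- T (- S x) - z *\<^sub>C (- S x) = x" for x
      using S(3)[of "- x"] by (simp add: neg neg' S_neg algebra_simps)
    ultimately have "z \<notin> op_spectrum (\<lambda>x. - T x)"
      unfolding op_spectrum_def by blast
    with z show False by blast
  qed
  then show "z \<in> uminus ` op_spectrum T"
    by (metis add.inverse_inverse image_eqI)
qed

lemma numerical_range_upper_bound:
  fixes T :: "'a ell2 \<Rightarrow> 'a ell2"
  assumes T: "bounded_clinear T" "selfadjoint T" and spec: "op_spectrum T \<subseteq> complex_of_real ` {a..b}"
  shows "inner (T x) x \<le> b * (norm x)\<^sup>2"
proof -
  have "bounded_clinear (\<lambda>x. - T x)"
    using T(1) by (auto simp: bounded_clinear_def bounded_linear_minus intro!: ell2_eqI)
  moreover have "selfadjoint (\<lambda>x. - T x)"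
  proof -
    have "cinner (- u) v = - cinner u v" "cinner u (- v) = - cinner u v" for u v :: "'a ell2"
      by (simp_all add: cinner.rep_eq infsum_uminus)
    then show ?thesis
      using T(2) by (simp add: selfadjoint_def is_cadjoint_def)
  qed
  moreover have "op_spectrum (\<lambda>x. - T x) \<subseteq> complex_of_real ` {- b..- a}"
    using op_spectrum_uminus[of T] spec by (force simp flip: of_real_minus)
  ultimately have "- b * (norm x)\<^sup>2 \<le> inner (- T x) x"
    by (rule numerical_range_lower_bound)
  then show ?thesis
    by simp
qed

text \<open>
  The witness is the eigenvector of the matrix read as a combination of the \<open>\<xi>\<^sub>w\<close>. It is fixed by
  \<^term>\<open>fock_proj N\<close>, so the quadratic forms of \<open>T\<close> and of its truncation agree on it.
\<close>

lemma truncation_eigenvalue_Rayleigh: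
  fixes T :: "'d::finite fock \<Rightarrow> 'd fock"
  assumes T: "bounded_clinear T" and l: "truncation_eigenvalues N T l"
    and i: "i \<in> {1..fock_dim TYPE('d) N}"
  obtains x where "x \<noteq> 0" "inner (T x) x = l i * (norm x)\<^sup>2"
proof -
  let ?n = "fock_dim TYPE('d) N" and ?A = "truncation_mat N T" and ?S = "truncation N T"
  let ?w = "\<lambda>m. word_enum N ! m :: 'd list"
  have A: "?A \<in> carrier_mat ?n ?n"
    by (simp add: truncation_mat_def)
  have "poly (char_poly ?A) (complex_of_real (l i)) = 0"
    using i unfolding l[unfolded truncation_eigenvalues_def] poly_prod
    by (intro prod_zero) auto
  then obtain v where v: "v \<in> carrier_vec ?n" "v \<noteq> 0\<^sub>v ?n" "?A *\<^sub>v v = complex_of_real (l i) \<cdot>\<^sub>v v"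
    unfolding eigenvalue_root_char_poly[OF A, symmetric] eigenvalue_def eigenvector_def
    using A by auto
  have inj: "?w p = ?w q \<longleftrightarrow> p = q" if "p < ?n" "q < ?n" for p q
    using nth_eq_iff_index_eq[OF word_enum(1)[of N, where ?'d = 'd]] that by (simp add: word_enum(3))
  have short: "length (?w p) \<le> N" if "p < ?n" for p
    using nth_mem[of p "word_enum N :: 'd list list"] that
    by (simp add: word_enum(2,3))
  define x where "x = (\<Sum>q<?n. vec_index v q *\<^sub>C ket (?w q))"
  have coord_x: "coord x (?w p) = vec_index v p" if "p < ?n" for p
  proof -
    have "coord x (?w p) = (\<Sum>q<?n. if q = p then vec_index v q else 0)"
      unfolding x_def coord_sum using that inj by (intro sum.cong refl) (auto simp: coord_ket)
    then show ?thesis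
      using that by simp
  qed
  have Px: "fock_proj N x = x"
  proof (rule ell2_eqI)
    fix w
    have "coord x w = 0" if "\<not> length w \<le> N"
      unfolding x_def coord_sum using that short by (intro sum.neutral) (auto simp: coord_ket)
    then show "coord (fock_proj N x) w = coord x w"
      by (simp add: fock_proj.rep_eq)
  qed
  have S_ev: "?S x = complex_of_real (l i) *\<^sub>C x"
  proof (rule ell2_eqI)
    fix w :: "'d list"
    show "coord (?S x) w = coord (complex_of_real (l i) *\<^sub>C x) w"
    proof (cases "length w \<le> N")
      case True
      then have "w \<in> set (word_enum N)"
        by (simp add: word_enum(2))
      then obtain p where p: "p < ?n" "w = ?w p"
        by (metis in_set_conv_nth word_enum(3))
      have "coord (?S x) w = (\<Sum>q<?n. ?A $$ (p, q) * vec_index v q)"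
        using p unfolding x_def
        by (simp add: bounded_clinearD[OF bounded_clinear_truncation[OF T]] coord_sum truncation_mat_def
            cinner_ket_right mult.commute)
      also have "\<dots> = vec_index (?A *\<^sub>v v) p"
        using p A v(1) by (simp add: scalar_prod_def atLeast0LessThan)
      finally show ?thesis
        using p v(1,3) coord_x by simp
    next
      case False
      then show ?thesis
        by (subst Px[symmetric]) (simp add: truncation_def fock_proj.rep_eq)
    qed
  qed
  have "cinner (T x) x = cinner (T (fock_proj N x)) (fock_proj N x)"
    by (simp add: Px)
  also have "\<dots> = cinner (?S x) x"
  proof -
    have "cinner (fock_proj N u) v = cinner u (fock_proj N v)" for u v :: "'d fock"
      using fock_proj_selfadjoint unfolding selfadjoint_def is_cadjoint_def by blast
    then show ?thesis
      by (simp only: truncation_def comp_apply)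
  qed
  also have "\<dots> = complex_of_real (l i) * cinner x x"
    by (simp add: S_ev cinner_scaleC_left)
  finally have "inner (T x) x = l i * (norm x)\<^sup>2"
    by (simp add: inner_ell2_def power2_norm_eq_inner)
  moreover have "x \<noteq> 0"
  proof
    assume "x = 0"
    then have "vec_index v p = 0" if "p < ?n" for p
      using coord_x[OF that] by simp
    with v(1,2) show False
      by auto
  qed
  ultimately show ?thesis
    using that by blast
qed

lemma truncation_eigenvalue_bounds:
  fixes T :: "'d::finite fock \<Rightarrow> 'd fock"
  assumes T: "bounded_clinear T" and l: "truncation_eigenvalues N T l"
    and i: "i \<in> {1..fock_dim TYPE('d) N}"
    and range: "\<And>x. a * (norm x)\<^sup>2 \<le> inner (T x) x" "\<And>x. inner (T x) x \<le> b * (norm x)\<^sup>2"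
  shows "l i \<in> {a..b}"
proof -
  obtain x where x: "x \<noteq> 0" "inner (T x) x = l i * (norm x)\<^sup>2"
    by (rule truncation_eigenvalue_Rayleigh[OF T l i])
  with range[of x] show ?thesis
    by simp
qed


section \<open>Limits of empirical distributions\<close>

text \<open>
  Convergence for monomials extends to polynomials by linearity and to continuous functions by
  Weierstrass approximation on \<open>[a, b]\<close>, where all the points \<open>x N i\<close> lie.
\<close>

lemma convergent_averages_of_convergent_moments:
  fixes x :: "nat \<Rightarrow> nat \<Rightarrow> real" and n :: "nat \<Rightarrow> nat" and f :: "real \<Rightarrow> real"
  assumes n: "\<And>N. 0 < n N"
    and bounds: "\<And>N i. i \<in> {1..n N} \<Longrightarrow> x N i \<in> {a..b}"
    and moments: "\<And>k. convergent (\<lambda>N. (\<Sum>i=1..n N. x N i ^ k) / real (n N))"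
    and f: "continuous_on UNIV f"
  shows "convergent (\<lambda>N. (\<Sum>i=1..n N. f (x N i)) / real (n N))"
proof -
  define avg where "avg g N = (\<Sum>i=1..n N. g (x N i)) / real (n N)" for g :: "real \<Rightarrow> real" and N
  have "Cauchy (avg f)"
  proof (rule metric_CauchyI)
    fix e :: real assume e: "0 < e"
    obtain p where p: "real_polynomial_function p" "\<And>y. y \<in> {a..b} \<Longrightarrow> \<bar>f y - p y\<bar> < e / 4"
      using Stone_Weierstrass_real_polynomial_function[of "{a..b}" f "e / 4"] e
        continuous_on_subset[OF f] by auto
    obtain c m where cm: "p = (\<lambda>y. \<Sum>k\<le>m. c k * y ^ k)"
      using p(1) unfolding real_polynomial_function_iff_sum by blast
    have "avg p = (\<lambda>N. \<Sum>k\<le>m. c k * ((\<Sum>i=1..n N. x N i ^ k) / real (n N)))"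
      by (simp add: fun_eq_iff avg_def cm sum_divide_distrib sum_distrib_left sum.swap[of _ "{..m}"])
    then have "convergent (avg p)"
      by (simp only:) (intro convergent_sum convergent_mult convergent_const moments)
    then obtain K where K: "\<And>M N. K \<le> M \<Longrightarrow> K \<le> N \<Longrightarrow> dist (avg p M) (avg p N) < e / 4"
      using metric_CauchyD[OF convergent_Cauchy, of "avg p" "e / 4"] e by auto
    have close: "\<bar>avg f N - avg p N\<bar> \<le> e / 4" for N
    proof -
      have "\<bar>avg f N - avg p N\<bar> = \<bar>\<Sum>i=1..n N. f (x N i) - p (x N i)\<bar> / real (n N)"
        by (simp add: avg_def sum_subtractf flip: diff_divide_distrib)
      also have "\<dots> \<le> (\<Sum>i=1..n N. e / 4) / real (n N)"
        by (intro divide_right_mono order.trans[OF sum_abs] sum_mono less_imp_le p(2) bounds) (auto simp: n)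
      also have "\<dots> = e / 4"
        using n[of N] by simp
      finally show ?thesis .
    qed
    have "dist (avg f M) (avg f N) < e" if "K \<le> M" "K \<le> N" for M N
      using K[OF that] close[of M] close[of N] unfolding dist_real_def by linarith
    then show "\<exists>K. \<forall>M\<ge>K. \<forall>N\<ge>K. dist (avg f M) (avg f N) < e"
      by blast
  qed
  then show ?thesis
    by (simp add: Cauchy_convergent_iff avg_def[abs_def])
qed

definition empirical_distribution :: "nat \<Rightarrow> (nat \<Rightarrow> real) \<Rightarrow> real measure" where
  "empirical_distribution n x = distr (measure_pmf (pmf_of_set {1..n})) borel x"

lemma real_distribution_empirical: "real_distribution (empirical_distribution n x)"
  unfolding empirical_distribution_def
  by (intro prob_space.real_distribution_distr measure_pmf.prob_space_axioms) simp

lemma integral_empirical: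
  fixes f :: "real \<Rightarrow> 'b::{banach, second_countable_topology}"
  assumes "0 < n" and "f \<in> borel_measurable borel"
  shows "(\<integral>y. f y \<partial>empirical_distribution n x) = (1 / real n) *\<^sub>R (\<Sum>i=1..n. f (x i))"
proof -
  have "(\<integral>y. f y \<partial>empirical_distribution n x) = (\<integral>i. f (x i) \<partial>measure_pmf (pmf_of_set {1..n}))"
    unfolding empirical_distribution_def by (rule integral_distr) (simp_all add: assms)
  also have "\<dots> = (\<Sum>i=1..n. pmf (pmf_of_set {1..n}) i *\<^sub>R f (x i))"
    by (rule integral_measure_pmf) (use assms in auto)
  also have "\<dots> = (1 / real n) *\<^sub>R (\<Sum>i=1..n. f (x i))"
    unfolding scaleR_sum_right using assms by (intro sum.cong) auto
  finally show ?thesis .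
qed

lemma tight_empirical:
  assumes n: "\<And>N. 0 < n N"
    and bounds: "\<And>N i. i \<in> {1..n N} \<Longrightarrow> x N i \<in> {a..b}"
  shows "tight (\<lambda>N. empirical_distribution (n N) (x N))"
  unfolding tight_def
proof (intro conjI allI impI)
  fix e :: real assume e: "0 < e"
  have "a \<le> b"
    using bounds[of 1 0] n[of 0] by auto
  have "measure (empirical_distribution (n N) (x N)) {a - 1<..b} = 1" for N
  proof -
    have "measure (empirical_distribution (n N) (x N)) {a - 1<..b}
        = measure_pmf.prob (pmf_of_set {1..n N}) (x N -` {a - 1<..b})"
      unfolding empirical_distribution_def by (subst measure_distr) auto
    also have "\<dots> = 1"
    proof (subst measure_pmf.prob_eq_1)
      show "AE i in measure_pmf (pmf_of_set {1..n N}). i \<in> x N -` {a - 1<..b}"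
        using n[of N] bounds[of _ N] by (fastforce simp: AE_measure_pmf_iff)
    qed simp
    finally show ?thesis .
  qed
  then show "\<exists>u v. u < v \<and> (\<forall>N. 1 - e < measure (empirical_distribution (n N) (x N)) {u<..v})"
    using e \<open>a \<le> b\<close> by (intro exI[of _ "a - 1"] exI[of _ b]) auto
qed (rule real_distribution_empirical)

text \<open>
  For \<open>a \<le> b\<close>, the distance from \<open>y\<close> to the interval \<open>[a, b]\<close>. As a continuous function that vanishes exactly on
  the interval, it detects mass outside.
\<close>

definition excess :: "real \<Rightarrow> real \<Rightarrow> real \<Rightarrow> real" where
  "excess a b y = max 0 (a - y) + max 0 (y - b)"

lemma excess_eq_0_iff: "excess a b y = 0 \<longleftrightarrow> y \<in> {a..b}"
  by (auto simp: excess_def)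

lemma continuous_on_excess: "continuous_on S (excess a b)"
  unfolding excess_def by (intro continuous_intros)

text \<open>
  All the empirical distributions live on \<open>[a, b]\<close>, so they are tight and Helly's selection theorem
  yields a subsequence with a weak limit \<open>\<mu>\<close>. Along the whole sequence the averages are known to
  converge, so they converge to the integral against \<open>\<mu>\<close>. Weak convergence controls bounded functions
  only; an arbitrary continuous \<open>f\<close> is replaced by its composition with the retraction of the line onto
  \<open>[a, b]\<close>, which changes neither the averages nor, \<open>\<mu>\<close> being carried by \<open>[a, b]\<close>, the integral.
\<close>

lemma ex_limit_of_empirical_distributions:
  fixes x :: "nat \<Rightarrow> nat \<Rightarrow> real" and n :: "nat \<Rightarrow> nat"
  assumes n: "\<And>N. 0 < n N"
    and bounds: "\<And>N i. i \<in> {1..n N} \<Longrightarrow> x N i \<in> {a..b}"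
    and moments: "\<And>k. convergent (\<lambda>N. (\<Sum>i=1..n N. x N i ^ k) / real (n N))"
  obtains \<mu> where "real_distribution \<mu>"
    and "\<And>f :: real \<Rightarrow> complex. continuous_on UNIV f \<Longrightarrow> integrable \<mu> f \<and>
      (\<lambda>N. 1 / of_nat (n N) * (\<Sum>i=1..n N. f (x N i))) \<longlonglongrightarrow> (\<integral>y. f y \<partial>\<mu>)"
proof -
  have ab: "a \<le> b"
    using bounds[of 1 0] n[of 0] by auto
  define E where "E N = empirical_distribution (n N) (x N)" for N
  have "tight E"
    using tight_empirical[OF n bounds] by (simp add: E_def[abs_def])
  then obtain r \<mu> where r: "strict_mono (r :: nat \<Rightarrow> nat)" and \<mu>: "real_distribution \<mu>"
    and weak: "weak_conv_m (E \<circ> r) \<mu>"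
    using tight_imp_convergent_subsubsequence[of E id] by (auto simp: comp_def strict_mono_id)
  interpret \<mu>: real_distribution \<mu> by (rule \<mu>)
  have E: "real_distribution ((E \<circ> r) N)" for N
    by (simp add: E_def real_distribution_empirical)
  have sub: "(\<lambda>N. 1 / of_nat (n (r N)) * (\<Sum>i=1..n (r N). g (x (r N) i))) \<longlonglongrightarrow> (\<integral>y. g y \<partial>\<mu>)"
    if g: "continuous_on UNIV g" "\<And>y. norm (g y) \<le> B" for g :: "real \<Rightarrow> complex" and B
  proof -
    have "(\<lambda>N. \<integral>y. g y \<partial>(E \<circ> r) N) \<longlonglongrightarrow> (\<integral>y. g y \<partial>\<mu>)"
      by (rule weak_conv_imp_integral_bdd_continuous_conv[OF E \<mu> weak _ g(2)])
        (use g(1) in \<open>auto simp: continuous_on_eq_continuous_at\<close>)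
    moreover have "(\<integral>y. g y \<partial>(E \<circ> r) N) = 1 / of_nat (n (r N)) * (\<Sum>i=1..n (r N). g (x (r N) i))" for N
      using n borel_measurable_continuous_onI[OF g(1)]
      by (simp add: E_def integral_empirical scaleR_conv_of_real)
    ultimately show ?thesis
      by simp
  qed
  have support: "AE y in \<mu>. y \<in> {a..b}"
  proof -
    let ?g = "\<lambda>y. min 1 (excess a b y)"
    have ge0: "0 \<le> ?g y" for y
      by (simp add: excess_def)
    have cont: "continuous_on UNIV ?g"
      by (intro continuous_intros continuous_on_excess)
    have "(\<lambda>N. 1 / of_nat (n (r N)) * (\<Sum>i=1..n (r N). complex_of_real (?g (x (r N) i))))
        \<longlonglongrightarrow> (\<integral>y. complex_of_real (?g y) \<partial>\<mu>)"
      by (rule sub[of _ 1]) (use ge0 cont in \<open>auto intro!: continuous_intros\<close>)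
    moreover have "?g (x N i) = 0" if "i \<in> {1..n N}" for N i
    proof -
      have "excess a b (x N i) = 0"
        using bounds[OF that] by (simp only: excess_eq_0_iff)
      then show ?thesis
        by simp
    qed
    then have "(\<Sum>i=1..n (r N). complex_of_real (?g (x (r N) i))) = 0" for N
      by (intro sum.neutral) simp
    ultimately have "(\<integral>y. complex_of_real (?g y) \<partial>\<mu>) = 0"
      by (simp only: mult_zero_right LIMSEQ_const_iff)
    then have "(\<integral>y. ?g y \<partial>\<mu>) = 0"
      by (simp only: integral_complex_of_real of_real_eq_0_iff)
    moreover have "integrable \<mu> ?g"
      by (rule \<mu>.integrable_const_bound[of _ 1])
        (use ge0 borel_measurable_continuous_onI[OF cont] in \<open>auto simp: abs_le_iff\<close>)
    ultimately have "AE y in \<mu>. ?g y = 0"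
      using integral_nonneg_eq_0_iff_AE[of \<mu> ?g] ge0 by simp
    then show ?thesis
    proof eventually_elim
      case (elim y)
      then have "excess a b y = 0"
        by (simp add: min_def split: if_splits)
      then show ?case
        by (simp only: excess_eq_0_iff)
    qed
  qed
  show ?thesis
  proof (rule that[OF \<mu>])
    fix f :: "real \<Rightarrow> complex" assume f: "continuous_on UNIV f"
    define clamp where "clamp y = max a (min b y)" for y
    have clamp: "clamp y = y" if "y \<in> {a..b}" for y
      using that by (auto simp: clamp_def)
    define g where "g y = f (clamp y)" for y
    have g: "continuous_on UNIV g"
      unfolding g_def clamp_def by (intro continuous_intros continuous_on_compose2[OF f]) auto
    have "bounded (f ` {a..b})"
      by (intro compact_imp_bounded compact_continuous_image continuous_on_subset[OF f]) auto
    then obtain B where "\<forall>y\<in>{a..b}. norm (f y) \<le> B"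
      by (auto simp: bounded_iff)
    then have B: "norm (g y) \<le> B" for y
      using ab by (simp add: g_def clamp_def)
    have int_g: "integrable \<mu> g"
      by (rule \<mu>.integrable_const_bound[of _ B])
        (use B borel_measurable_continuous_onI[OF g] in auto)
    have AE_eq: "AE y in \<mu>. g y = f y"
      using support by eventually_elim (simp add: g_def clamp)
    have meas: "f \<in> borel_measurable \<mu>" "g \<in> borel_measurable \<mu>"
      using borel_measurable_continuous_onI[OF f] borel_measurable_continuous_onI[OF g] by auto
    have "convergent (\<lambda>N. 1 / of_nat (n N) * (\<Sum>i=1..n N. f (x N i)))"
    proof -
      have "convergent (\<lambda>N. (\<Sum>i=1..n N. Re (f (x N i))) / real (n N))"
        by (rule convergent_averages_of_convergent_moments[OF n bounds moments])
          (auto intro!: continuous_intros f)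
      moreover have "convergent (\<lambda>N. (\<Sum>i=1..n N. Im (f (x N i))) / real (n N))"
        by (rule convergent_averages_of_convergent_moments[OF n bounds moments])
          (auto intro!: continuous_intros f)
      ultimately obtain u v where "(\<lambda>N. (\<Sum>i=1..n N. Re (f (x N i))) / real (n N)) \<longlonglongrightarrow> u"
        "(\<lambda>N. (\<Sum>i=1..n N. Im (f (x N i))) / real (n N)) \<longlonglongrightarrow> v"
        unfolding convergent_def by blast
      then have "(\<lambda>N. Complex ((\<Sum>i=1..n N. Re (f (x N i))) / real (n N))
          ((\<Sum>i=1..n N. Im (f (x N i))) / real (n N))) \<longlonglongrightarrow> Complex u v"
        by (rule tendsto_Complex)
      moreover have "Complex ((\<Sum>i=1..n N. Re (f (x N i))) / real (n N))
          ((\<Sum>i=1..n N. Im (f (x N i))) / real (n N)) = 1 / of_nat (n N) * (\<Sum>i=1..n N. f (x N i))" for N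
        by (simp add: complex_eq_iff Re_divide_of_nat Im_divide_of_nat)
      ultimately show ?thesis
        unfolding convergent_def by auto
    qed
    then obtain L where L: "(\<lambda>N. 1 / of_nat (n N) * (\<Sum>i=1..n N. f (x N i))) \<longlonglongrightarrow> L"
      unfolding convergent_def by blast
    have "(\<lambda>N. 1 / of_nat (n (r N)) * (\<Sum>i=1..n (r N). f (x (r N) i))) \<longlonglongrightarrow> (\<integral>y. g y \<partial>\<mu>)"
    proof -
      have "(\<Sum>i=1..n N. g (x N i)) = (\<Sum>i=1..n N. f (x N i))" for N
        by (intro sum.cong refl) (metis g_def clamp bounds)
      then show ?thesis
        using sub[OF g B] by simp
    qed
    moreover have "(\<lambda>N. 1 / of_nat (n (r N)) * (\<Sum>i=1..n (r N). f (x (r N) i))) \<longlonglongrightarrow> L"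
      using LIMSEQ_subseq_LIMSEQ[OF L r] by (simp add: comp_def)
    ultimately have "L = (\<integral>y. g y \<partial>\<mu>)"
      using LIMSEQ_unique by blast
    also have "\<dots> = (\<integral>y. f y \<partial>\<mu>)"
      by (rule integral_cong_AE[OF meas(2,1) AE_eq])
    finally show "integrable \<mu> f \<and>
      (\<lambda>N. 1 / of_nat (n N) * (\<Sum>i=1..n N. f (x N i))) \<longlonglongrightarrow> (\<integral>y. f y \<partial>\<mu>)"
      using L integrable_cong_AE[OF meas(2,1) AE_eq] int_g by simp
  qed
qed

text \<open>
  The functions \<open>y \<mapsto> exp(i t y)\<close> are among the test functions, so the two characteristic functions agree.
\<close>

lemma eigenvalue_limit_measure_unique:
  assumes "eigenvalue_limit_measure D l \<mu>" "eigenvalue_limit_measure D l \<nu>"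
  shows "\<mu> = \<nu>"
proof (rule Levy_uniqueness)
  show "real_distribution \<mu>" "real_distribution \<nu>"
    using assms by (auto simp: eigenvalue_limit_measure_def)
  show "char \<mu> = char \<nu>"
  proof
    fix t
    have "continuous_on UNIV (\<lambda>y. iexp (t * y))"
      by (intro continuous_intros)
    then show "char \<mu> t = char \<nu> t"
      using assms LIMSEQ_unique unfolding eigenvalue_limit_measure_def char_def by blast
  qed
qed

lemma eigenvalue_limit_measure_support:
  assumes \<mu>: "eigenvalue_limit_measure D l \<mu>"
    and bounds: "\<And>N i. i \<in> {1..fock_dim D N} \<Longrightarrow> l N i \<in> {a..b}"
  shows "emeasure \<mu> (UNIV - {a..b}) = 0"
proof -
  interpret \<mu>: real_distribution \<mu>
    using \<mu> by (simp add: eigenvalue_limit_measure_def)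
  let ?f = "\<lambda>y. complex_of_real (excess a b y)"
  have "continuous_on UNIV ?f"
    by (intro continuous_intros continuous_on_excess)
  then have int: "integrable \<mu> ?f"
    and lim: "(\<lambda>N. 1 / of_nat (fock_dim D N) * (\<Sum>i=1..fock_dim D N. ?f (l N i))) \<longlonglongrightarrow> (\<integral>y. ?f y \<partial>\<mu>)"
    using \<mu> unfolding eigenvalue_limit_measure_def by blast+
  have "(\<Sum>i=1..fock_dim D N. ?f (l N i)) = 0" for N
    using bounds[of _ N] excess_eq_0_iff[of a b] by (intro sum.neutral) auto
  with lim have "(\<integral>y. excess a b y \<partial>\<mu>) = 0"
    by (simp add: LIMSEQ_const_iff)
  moreover have "integrable \<mu> (excess a b)"
    using int by (simp add: complex_of_real_integrable_eq)
  moreover have "0 \<le> excess a b y" for y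
    by (simp add: excess_def)
  ultimately have "AE y in \<mu>. excess a b y = 0"
    using integral_nonneg_eq_0_iff_AE[of \<mu> "excess a b"] by simp
  then have "AE y in \<mu>. y \<notin> UNIV - {a..b}"
    by eventually_elim (simp add: excess_eq_0_iff)
  then show ?thesis
    by (subst (asm) AE_iff_measurable[of "UNIV - {a..b}"]) (auto)
qed


section \<open>Existence, uniqueness and support of the limit\<close>

theorem theorem2p6:
  fixes T :: "'d::finite fock \<Rightarrow> 'd fock"
    and l :: "nat \<Rightarrow> nat \<Rightarrow> real"
  assumes "CARD('d) \<ge> 2"
    and "bounded_clinear T"
    and "selfadjoint T"
    and "multi_toeplitz T"
    and "\<And>N. truncation_eigenvalues N T (l N)"
  shows "(\<exists>!\<mu>. eigenvalue_limit_measure TYPE('d) l \<mu>) \<and>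
    (\<forall>\<mu> a b. eigenvalue_limit_measure TYPE('d) l \<mu> \<longrightarrow> smallest_interval (op_spectrum T) a b
       \<longrightarrow> emeasure \<mu> (UNIV - {a..b}) = 0)"
proof -
  obtain K where K: "\<And>x. norm (T x) \<le> norm x * K"
    using bounded_linear.bounded[OF bounded_clinearD(1)[OF assms(2)]] by blast
  have "\<bar>inner (T x) x\<bar> \<le> K * (norm x)\<^sup>2" for x
  proof -
    have "\<bar>inner (T x) x\<bar> \<le> norm (T x) * norm x"
      by (rule Cauchy_Schwarz_ineq2)
    also have "\<dots> \<le> (norm x * K) * norm x"
      by (intro mult_right_mono K norm_ge_zero)
    finally show ?thesis
      by (simp only: power2_eq_square mult_ac)
  qed
  then have "- K * (norm x)\<^sup>2 \<le> inner (T x) x" "inner (T x) x \<le> K * (norm x)\<^sup>2" for x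
    by (simp_all add: abs_le_iff minus_le_iff)
  then have bounds: "l N i \<in> {- K..K}" if "i \<in> {1..fock_dim TYPE('d) N}" for N i
    by (rule truncation_eigenvalue_bounds[OF assms(2,5) that])
  obtain \<mu> where "eigenvalue_limit_measure TYPE('d) l \<mu>"
    using ex_limit_of_empirical_distributions[OF fock_dim_pos bounds
        convergent_eigenvalue_moments[OF assms(1,2,4,5)]]
    unfolding eigenvalue_limit_measure_def by metis
  then have "\<exists>!\<mu>. eigenvalue_limit_measure TYPE('d) l \<mu>"
    using eigenvalue_limit_measure_unique by blast
  moreover have "emeasure \<mu> (UNIV - {a..b}) = 0"
    if \<mu>: "eigenvalue_limit_measure TYPE('d) l \<mu>" and ab: "smallest_interval (op_spectrum T) a b" for \<mu> a b
  proof (rule eigenvalue_limit_measure_support[OF \<mu>])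
    fix N i assume i: "i \<in> {1..fock_dim TYPE('d) N}"
    have "op_spectrum T \<subseteq> complex_of_real ` {a..b}"
      using ab by (simp add: smallest_interval_def)
    from numerical_range_lower_bound[OF assms(2,3) this] numerical_range_upper_bound[OF assms(2,3) this]
    show "l N i \<in> {a..b}"
      by (rule truncation_eigenvalue_bounds[OF assms(2,5) i])
  qed
  ultimately show ?thesis
    by blast
qed

end
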